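(* Let $H(n)$ be as defined in the context (switching curves $y=\pm x^2$). Then $H(1)=4$; that is, for $n=1$ and every choice of coefficients for which $M\not\equiv 0$, the function $M(h)$ has at most $4$ zeros in $(0,+\infty)$ counted with multiplicity, and there exist coefficients for which $M$ has exactly $4$ zeros in $(0,+\infty)$. Moreover, for every $n\ge 2$, $$H(n)\le 2n+5\left[\tfrac{n-1}{2}\right]+4.$$
   Context: Fix an integer $n\ge 1$ and real coefficients $a^k_{i,j},b^k_{i,j}$ ($k=1,2,3,4$; integers $i,j\ge 0$, $i+j\le n$), and put $f_k(x,y)=\sum_{0\le i+j\le n}a^k_{i,j}x^iy^j$, $g_k(x,y)=\sum_{0\le i+j\le n}b^k_{i,j}x^iy^j$. Consider the piecewise smooth system $\dot x=y+\varepsilon f_k(x,y)$, $\dot y=-x+\varepsilon g_k(x,y)$ for $(x,y)\in R_k$, where $R_1=\{x>0,\,-x^2<y<x^2\}$, $R_2=\{y<-x^2\}$, $R_3=\{x<0,\,-x^2<y<x^2\}$, $R_4=\{y>x^2\}$ (switching curves $y=\pm x^2$). For $\varepsilon=0$ the orbits are the circles $\Gamma_h:\ x^2+y^2=h$, $h>0$, traversed clockwise. For $h>0$ let $u=u(h)=\sqrt{(\sqrt{1+4h}-1)/2}$, the unique positive number with $u^4+u^2=h$; $\Gamma_h$ meets $y=\pm x^2$ at $A=(u,u^2)$, $B=(u,-u^2)$, $C=(-u,-u^2)$, $D=(-u,u^2)$. Let $\widehat{AB},\widehat{BC},\widehat{CD},\widehat{DA}$ be the arcs of $\Gamma_h$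 traversed clockwise from $A$ to $B$ (through $(\sqrt h,0)$), from $B$ to $C$ (through $(0,-\sqrt h)$), from $C$ to $D$ (through $(-\sqrt h,0)$), from $D$ to $A$ (through $(0,\sqrt h)$); line integrals are taken along these oriented arcs. The first order Melnikov function is $$M(h)=\int_{\widehat{AB}}g_1dx-f_1dy+\int_{\widehat{BC}}g_2dx-f_2dy+\int_{\widehat{CD}}g_3dx-f_3dy+\int_{\widehat{DA}}g_4dx-f_4dy,\quad h\in(0,+\infty).$$ $H(n)$ denotes the maximum, over all real coefficient choices with $M\not\equiv 0$, of the number of zeros of $M$ in $(0,+\infty)$ counted with multiplicity (this bounds, via first order Melnikov theory, the number of limit cycles bifurcating for small $|\varepsilon|$ from the period annulus around the origin). $[p]$ denotes the integer part of $p$. *)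

theory Defs
  imports "HOL-Analysis.Analysis" "HOL-Library.Extended_Nat"
begin

definition poly2 :: "nat \<Rightarrow> (nat \<Rightarrow> nat \<Rightarrow> real) \<Rightarrow> real \<Rightarrow> real \<Rightarrow> real" where
  "poly2 n c x y = (\<Sum>i\<le>n. \<Sum>j\<le>n - i. c i j * x ^ i * y ^ j)"

text \<open>u(h): the unique positive number with u^4 + u^2 = h.\<close>
definition uh :: "real \<Rightarrow> real" where
  "uh h = sqrt ((sqrt (1 + 4 * h) - 1) / 2)"

text \<open>Clockwise parametrisation of the circle x^2+y^2=h:
  t \<mapsto> (sqrt h * sin t, sqrt h * cos t).  The point A = (u,u^2) corresponds to
  t = thA h, B to pi - thA h, C to pi + thA h, D to 2 pi - thA h (equivalently -thA h).\<close>
definition thA :: "real \<Rightarrow> real" where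
  "thA h = arctan (1 / uh h)"

text \<open>Line integral of g dx - f dy along the clockwise arc of x^2+y^2=h
  from parameter t0 to t1, written out via the parametrisation above
  (dx = sqrt h cos t dt, dy = - sqrt h sin t dt).\<close>
definition arc_int :: "(real \<Rightarrow> real \<Rightarrow> real) \<Rightarrow> (real \<Rightarrow> real \<Rightarrow> real) \<Rightarrow> real \<Rightarrow> real \<Rightarrow> real \<Rightarrow> real" where
  "arc_int f g h t0 t1 =
     integral {t0..t1} (\<lambda>t. g (sqrt h * sin t) (sqrt h * cos t) * (sqrt h * cos t)
                            - f (sqrt h * sin t) (sqrt h * cos t) * (- (sqrt h * sin t)))"

definition melnikov :: "nat \<Rightarrow> (nat \<Rightarrow> nat \<Rightarrow> nat \<Rightarrow> real) \<Rightarrow> (nat \<Rightarrow> nat \<Rightarrow> nat \<Rightarrow> real) \<Rightarrow> real \<Rightarrow> real" where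
  "melnikov n a b h =
     (let \<theta> = thA h in
        arc_int (poly2 n (a 1)) (poly2 n (b 1)) h \<theta> (pi - \<theta>)
      + arc_int (poly2 n (a 2)) (poly2 n (b 2)) h (pi - \<theta>) (pi + \<theta>)
      + arc_int (poly2 n (a 3)) (poly2 n (b 3)) h (pi + \<theta>) (2 * pi - \<theta>)
      + arc_int (poly2 n (a 4)) (poly2 n (b 4)) h (2 * pi - \<theta>) (2 * pi + \<theta>))"

definition zero_mult :: "(real \<Rightarrow> real) \<Rightarrow> real \<Rightarrow> enat" where
  "zero_mult F x = (if \<exists>k. (deriv ^^ k) F x \<noteq> 0
                    then enat (LEAST k. (deriv ^^ k) F x \<noteq> 0) else \<infinity>)"

definition nzeros_pos :: "(real \<Rightarrow> real) \<Rightarrow> enat" where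
  "nzeros_pos F = (if finite {x. 0 < x \<and> F x = 0}
                   then (\<Sum>x\<in>{x. 0 < x \<and> F x = 0}. zero_mult F x) else \<infinity>)"

definition Hn :: "nat \<Rightarrow> enat" where
  "Hn n = Sup {nzeros_pos (melnikov n a b) | a b. \<exists>h>0. melnikov n a b h \<noteq> 0}"

end

theory Submission
  imports Defs
begin

text \<open>
  With \<open>u = uh h\<close> one has \<open>thA h = pi / 2 - arctan u\<close>, and antiderivatives of homogeneous trigonometric
  polynomials are homogeneous up to a linear term, so \<open>M(h) = u * (P(u) + R(u) * arctan u)\<close> with \<open>P\<close>
  and \<open>R\<close> of degree at most \<open>2 * n + 1\<close> and \<open>R\<close> odd. Differentiating \<open>M / u\<close> with respect to \<open>u\<close>
  exactly \<open>N = 2 * n + 2\<close> times kills \<open>P\<close> and leaves \<open>W(u) / (1 + u\<^sup>2) ^ N\<close> with \<open>W\<close> even of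
  degree less than \<open>N\<close>, hence at most \<open>n\<close> positive zeros. Rolle's theorem, counting multiplicities,
  gives at most \<open>3 * n + 2\<close> zeros of \<open>M\<close>, which is within the bound for \<open>n \<ge> 2\<close>.

  For \<open>n = 1\<close>, \<open>P\<close> is an arbitrary cubic and \<open>R(u)\<close> is a multiple of \<open>u + u ^ 3\<close>; the fourth derivative
  of \<open>(u + u ^ 3) * arctan u\<close> is \<open>16 / (1 + u\<^sup>2) ^ 3 > 0\<close>, so there are at most four zeros, and
  interpolation by \<open>P\<close> at four points attains this.
\<close>

section \<open>Counting zeros with multiplicity\<close>

fun diffble_upto :: "nat \<Rightarrow> (real \<Rightarrow> real) \<Rightarrow> real \<Rightarrow> bool" where
  "diffble_upto 0 F x = True"
| "diffble_upto (Suc k) F x \<longleftrightarrow>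
     (\<forall>\<^sub>F y in nhds x. F field_differentiable at y) \<and> diffble_upto k (deriv F) x"

text \<open>This encodes "zero of multiplicity at least \<open>k\<close>". Differentiability is
  demanded in a whole neighbourhood at each level, so that \<open>deriv\<close> is a genuine
  derivative there and the notion depends only on the germ of \<open>F\<close> at
  \<open>x\<close>.\<close>

fun vanishes_upto :: "nat \<Rightarrow> (real \<Rightarrow> real) \<Rightarrow> real \<Rightarrow> bool" where
  "vanishes_upto 0 F x = True"
| "vanishes_upto (Suc k) F x \<longleftrightarrow> F x = 0 \<and>
     (\<forall>\<^sub>F y in nhds x. F field_differentiable at y) \<and> vanishes_upto k (deriv F) x"

lemma eventually_eq_deriv:
  fixes F G :: "real \<Rightarrow> real"
  assumes "\<forall>\<^sub>F y in nhds x. F y = G y"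
  shows "\<forall>\<^sub>F y in nhds x. deriv F y = deriv G y"
proof -
  have "\<forall>\<^sub>F y in nhds x. \<forall>\<^sub>F z in nhds y. F z = G z"
    using assms by (simp add: eventually_eventually)
  then show ?thesis
    by eventually_elim (auto intro: deriv_cong_ev)
qed

lemma eventually_eq_field_differentiable:
  fixes F G :: "real \<Rightarrow> real"
  assumes "\<forall>\<^sub>F y in nhds x. F y = G y" and "\<forall>\<^sub>F y in nhds x. F field_differentiable at y"
  shows "\<forall>\<^sub>F y in nhds x. G field_differentiable at y"
proof -
  have "\<forall>\<^sub>F y in nhds x. \<forall>\<^sub>F z in nhds y. F z = G z"
    using assms(1) by (simp add: eventually_eventually)
  with assms(2) show ?thesis
  proof eventually_elim
    case (elim y)
    then obtain D where "(F has_field_derivative D) (at y)"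
      by (auto simp: field_differentiable_def)
    then have "(G has_field_derivative D) (at y)"
      using elim(2) DERIV_cong_ev[OF refl elim(2) refl] by simp
    then show ?case by (auto simp: field_differentiable_def)
  qed
qed

lemma diffble_upto_cong:
  "\<forall>\<^sub>F y in nhds x. F y = G y \<Longrightarrow> diffble_upto k F x \<Longrightarrow> diffble_upto k G x"
proof (induction k arbitrary: F G)
  case (Suc k)
  then show ?case
    using eventually_eq_field_differentiable[OF Suc.prems(1)]
      Suc.IH[OF eventually_eq_deriv[OF Suc.prems(1)]] by simp
qed simp

lemma vanishes_upto_cong:
  "\<forall>\<^sub>F y in nhds x. F y = G y \<Longrightarrow> vanishes_upto k F x \<Longrightarrow> vanishes_upto k G x"
proof (induction k arbitrary: F G)
  case (Suc k)
  then show ?case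
    using eventually_eq_field_differentiable[OF Suc.prems(1)] eventually_nhds_x_imp_x[OF Suc.prems(1)]
      Suc.IH[OF eventually_eq_deriv[OF Suc.prems(1)]] by simp
qed simp

lemma eventually_has_derivativeD:
  fixes F F' :: "real \<Rightarrow> real"
  assumes "\<forall>\<^sub>F y in nhds x. (F has_real_derivative F' y) (at y)"
  shows "\<forall>\<^sub>F y in nhds x. F field_differentiable at y" "\<forall>\<^sub>F y in nhds x. F' y = deriv F y"
    "\<forall>\<^sub>F y in nhds x. deriv F y = F' y"
  using assms by (eventually_elim; auto simp: field_differentiable_def DERIV_imp_deriv)+

text \<open>Serves to replace \<open>deriv F\<close> by an explicit derivative \<open>F'\<close>:
  the two agree near \<open>x\<close>, and only the germ matters.\<close>

lemma diffble_uptoI: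
  assumes "\<forall>\<^sub>F y in nhds x. (F has_real_derivative F' y) (at y)" and "diffble_upto k F' x"
  shows "diffble_upto (Suc k) F x"
  using assms eventually_has_derivativeD[OF assms(1)] by (auto intro: diffble_upto_cong)

lemma vanishes_uptoI:
  assumes "\<forall>\<^sub>F y in nhds x. (F has_real_derivative F' y) (at y)" and "vanishes_upto k F' x" "F x = 0"
  shows "vanishes_upto (Suc k) F x"
  using assms eventually_has_derivativeD[OF assms(1)] by (auto intro: vanishes_upto_cong)

lemma vanishes_upto_derivative:
  assumes "vanishes_upto k F x" and "\<forall>\<^sub>F y in nhds x. (F has_real_derivative F' y) (at y)"
  shows "vanishes_upto (k - 1) F' x"
  using assms eventually_has_derivativeD[OF assms(2)]
  by (cases k) (auto intro: vanishes_upto_cong)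

lemma eventually_has_derivative_deriv:
  fixes F :: "real \<Rightarrow> real"
  assumes "\<forall>\<^sub>F y in nhds x. F field_differentiable at y"
  shows "\<forall>\<^sub>F y in nhds x. (F has_real_derivative deriv F y) (at y)"
  using assms by eventually_elim (simp add: DERIV_deriv_iff_field_differentiable)

lemma diffble_upto_Suc_imp: "diffble_upto (Suc k) F x \<Longrightarrow> diffble_upto k F x"
  by (induction k arbitrary: F) auto

lemma vanishes_upto_Suc_imp: "vanishes_upto (Suc k) F x \<Longrightarrow> vanishes_upto k F x"
  by (induction k arbitrary: F) auto

lemma diffble_upto_const [simp]: "diffble_upto k (\<lambda>_. c) x"
  by (induction k arbitrary: c)
     (auto intro!: diffble_uptoI[where F' = "\<lambda>_. 0"] simp del: diffble_upto.simps(2))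

lemma diffble_upto_ident [simp]: "diffble_upto k (\<lambda>y. y) x"
  by (cases k)
     (auto intro!: diffble_uptoI[where F' = "\<lambda>_. 1"] simp del: diffble_upto.simps(2))

lemma eventually_DERIV_add:
  fixes F G :: "real \<Rightarrow> real"
  assumes "\<forall>\<^sub>F y in nhds x. F field_differentiable at y" "\<forall>\<^sub>F y in nhds x. G field_differentiable at y"
  shows "\<forall>\<^sub>F y in nhds x. ((\<lambda>y. F y + G y) has_real_derivative deriv F y + deriv G y) (at y)"
  using assms[THEN eventually_has_derivative_deriv]
  by eventually_elim (auto intro!: derivative_eq_intros)

lemma diffble_upto_add:
  "diffble_upto k F x \<Longrightarrow> diffble_upto k G x \<Longrightarrow> diffble_upto k (\<lambda>y. F y + G y) x"
proof (induction k arbitrary: F G)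
  case (Suc k)
  have "\<forall>\<^sub>F y in nhds x. ((\<lambda>y. F y + G y) has_real_derivative deriv F y + deriv G y) (at y)"
    using Suc.prems by (intro eventually_DERIV_add) auto
  then show ?case using Suc.IH Suc.prems by (rule_tac diffble_uptoI) auto
qed simp

lemma vanishes_upto_add:
  "vanishes_upto k F x \<Longrightarrow> vanishes_upto k G x \<Longrightarrow> vanishes_upto k (\<lambda>y. F y + G y) x"
proof (induction k arbitrary: F G)
  case (Suc k)
  have "\<forall>\<^sub>F y in nhds x. ((\<lambda>y. F y + G y) has_real_derivative deriv F y + deriv G y) (at y)"
    using Suc.prems by (intro eventually_DERIV_add) auto
  then show ?case using Suc by (intro vanishes_uptoI) auto
qed simp

lemma eventually_DERIV_mult:
  fixes F G :: "real \<Rightarrow> real"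
  assumes "\<forall>\<^sub>F y in nhds x. F field_differentiable at y" "\<forall>\<^sub>F y in nhds x. G field_differentiable at y"
  shows "\<forall>\<^sub>F y in nhds x. ((\<lambda>y. F y * G y) has_real_derivative deriv F y * G y + F y * deriv G y) (at y)"
  using assms[THEN eventually_has_derivative_deriv]
  by eventually_elim (auto intro!: derivative_eq_intros)

lemma diffble_upto_mult:
  "diffble_upto k F x \<Longrightarrow> diffble_upto k G x \<Longrightarrow> diffble_upto k (\<lambda>y. F y * G y) x"
proof (induction k arbitrary: F G)
  case (Suc k)
  have ev: "\<forall>\<^sub>F y in nhds x. ((\<lambda>y. F y * G y) has_real_derivative deriv F y * G y + F y * deriv G y) (at y)"
    using Suc.prems by (intro eventually_DERIV_mult) auto
  moreover have "diffble_upto k F x" "diffble_upto k G x"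
    using Suc.prems diffble_upto_Suc_imp by blast+
  moreover have "diffble_upto k (\<lambda>y. deriv F y * G y + F y * deriv G y) x"
    using calculation Suc.prems by (intro diffble_upto_add Suc.IH) auto
  ultimately show ?case by (intro diffble_uptoI[OF ev])
qed simp

text \<open>In the product rule one summand keeps the factor \<open>G\<close> and the other has
  \<open>deriv G\<close>, and both still vanish to one order less. Hence a smooth factor never
  lowers the order of a zero.\<close>

lemma vanishes_upto_mult:
  "diffble_upto k F x \<Longrightarrow> vanishes_upto k G x \<Longrightarrow> vanishes_upto k (\<lambda>y. F y * G y) x"
proof (induction k arbitrary: F G)
  case (Suc k)
  have ev: "\<forall>\<^sub>F y in nhds x. ((\<lambda>y. F y * G y) has_real_derivative deriv F y * G y + F y * deriv G y) (at y)"
    using Suc.prems by (intro eventually_DERIV_mult) auto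
  moreover have "diffble_upto k F x" "vanishes_upto k G x"
    using Suc.prems diffble_upto_Suc_imp vanishes_upto_Suc_imp by blast+
  moreover have "vanishes_upto k (\<lambda>y. deriv F y * G y + F y * deriv G y) x"
    using calculation Suc.prems by (intro vanishes_upto_add Suc.IH) auto
  ultimately show ?case using Suc.prems by (intro vanishes_uptoI[OF ev]) auto
qed simp

lemma diffble_upto_Suc_continuous:
  assumes "diffble_upto (Suc k) G x" "eventually P (nhds (G x))"
  shows "\<forall>\<^sub>F y in nhds x. P (G y)"
proof -
  have "G field_differentiable at x"
    using assms(1) eventually_nhds_x_imp_x[of "\<lambda>y. G field_differentiable at y" x] by simp
  then have "isCont G x" using field_differentiable_imp_continuous_at by blast
  then have "filterlim G (nhds (G x)) (nhds x)"
    by (simp add: isCont_def tendsto_at_iff_tendsto_nhds)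
  then show ?thesis using assms(2) by (simp add: filterlim_iff)
qed

lemma eventually_DERIV_compose:
  assumes "diffble_upto (Suc k) G x" "\<forall>\<^sub>F y in nhds (G x). F field_differentiable at y"
  shows "\<forall>\<^sub>F y in nhds x. ((\<lambda>y. F (G y)) has_real_derivative deriv G y * deriv F (G y)) (at y)"
proof -
  have "\<forall>\<^sub>F y in nhds x. (F has_real_derivative deriv F (G y)) (at (G y))"
    using diffble_upto_Suc_continuous[OF assms(1) eventually_has_derivative_deriv[OF assms(2)]] .
  moreover have "\<forall>\<^sub>F y in nhds x. (G has_real_derivative deriv G y) (at y)"
    using assms(1) eventually_has_derivative_deriv by auto
  ultimately show ?thesis
  proof eventually_elim
    case (elim y)
    show ?case using DERIV_chain2[OF elim] by (simp add: mult.commute)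
  qed
qed

text \<open>The chain rule gives \<open>deriv G\<close> times a composition with
  \<open>deriv F\<close>, so the induction varies \<open>F\<close> while \<open>G\<close> stays
  fixed.\<close>

lemma diffble_upto_compose:
  "diffble_upto k F (G x) \<Longrightarrow> diffble_upto k G x \<Longrightarrow> diffble_upto k (\<lambda>y. F (G y)) x"
proof (induction k arbitrary: F)
  case (Suc k)
  have "\<forall>\<^sub>F y in nhds x. ((\<lambda>y. F (G y)) has_real_derivative deriv G y * deriv F (G y)) (at y)"
    using Suc.prems by (intro eventually_DERIV_compose) auto
  moreover have "diffble_upto k (\<lambda>y. deriv F (G y)) x"
    using Suc.IH[of "deriv F"] Suc.prems(1) diffble_upto_Suc_imp[OF Suc.prems(2)] by simp
  then have "diffble_upto k (\<lambda>y. deriv G y * deriv F (G y)) x"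
    using Suc.prems(2) by (simp add: diffble_upto_mult)
  ultimately show ?case by (intro diffble_uptoI) auto
qed simp

lemma vanishes_upto_compose:
  "vanishes_upto k F (G x) \<Longrightarrow> diffble_upto k G x \<Longrightarrow> vanishes_upto k (\<lambda>y. F (G y)) x"
proof (induction k arbitrary: F)
  case (Suc k)
  have "\<forall>\<^sub>F y in nhds x. ((\<lambda>y. F (G y)) has_real_derivative deriv G y * deriv F (G y)) (at y)"
    using Suc.prems by (intro eventually_DERIV_compose) auto
  moreover have "vanishes_upto k (\<lambda>y. deriv F (G y)) x"
    using Suc.IH[of "deriv F"] Suc.prems(1) diffble_upto_Suc_imp[OF Suc.prems(2)] by simp
  then have "vanishes_upto k (\<lambda>y. deriv G y * deriv F (G y)) x"
    using Suc.prems(2) by (simp add: vanishes_upto_mult)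
  ultimately show ?case using Suc.prems by (intro vanishes_uptoI) auto
qed simp

lemma diffble_upto_poly [simp]: "diffble_upto k (poly p) x"
proof (induction k arbitrary: p)
  case (Suc k)
  then show ?case by (intro diffble_uptoI[where F' = "poly (pderiv p)"] always_eventually) (auto)
qed simp

text \<open>The constant \<open>c\<close> makes the family closed under differentiation:
  \<open>c\<close> becomes \<open>c * a\<close> and the exponent drops by one.\<close>

lemma diffble_upto_powr: "x > 0 \<Longrightarrow> diffble_upto k (\<lambda>y. c * y powr a) x"
proof (induction k arbitrary: c a)
  case (Suc k)
  have "\<forall>\<^sub>F y in nhds x. y \<in> {0<..}"
    using Suc.prems by (intro eventually_nhds_in_open) auto
  then have "\<forall>\<^sub>F y in nhds x. ((\<lambda>y. c * y powr a) has_real_derivative (c * a) * y powr (a - 1)) (at y)"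
    by eventually_elim (auto intro!: derivative_eq_intros)
  then show ?case using Suc.IH Suc.prems by (rule_tac diffble_uptoI) auto
qed simp

lemma diffble_upto_inverse_square_plus_one [simp]: "diffble_upto k (\<lambda>y. 1 / (1 + y\<^sup>2)) x"
proof -
  have "poly [:1, 0, 1:] x > 0" by (simp add: add_pos_nonneg)
  then have "diffble_upto k (\<lambda>y. 1 * (poly [:1, 0, 1:] y) powr (-1)) x"
    by (rule diffble_upto_compose[OF diffble_upto_powr diffble_upto_poly])
  moreover have "1 * (poly [:1, 0, 1:] y) powr (-1) = 1 / (1 + y\<^sup>2)" for y :: real
    by (simp add: powr_minus_divide power2_eq_square add_nonneg_nonneg)
  ultimately show ?thesis by simp
qed

lemma diffble_upto_arctan [simp]: "diffble_upto k arctan x"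
proof (cases k)
  case (Suc l)
  have "(arctan has_real_derivative 1 / (1 + y\<^sup>2)) (at y)" for y
    by (auto intro!: derivative_eq_intros simp: inverse_eq_divide)
  then show ?thesis unfolding Suc
    by (intro diffble_uptoI[where F' = "\<lambda>y. 1 / (1 + y\<^sup>2)"] always_eventually allI) auto
qed simp

lemma vanishes_uptoI_higher_deriv:
  assumes "diffble_upto k F x" and "\<And>i. i < k \<Longrightarrow> (deriv ^^ i) F x = 0"
  shows "vanishes_upto k F x"
  using assms
proof (induction k arbitrary: F)
  case (Suc k)
  have "(deriv ^^ i) (deriv F) x = 0" if "i < k" for i
    using Suc.prems(2)[of "Suc i"] that by (simp add: funpow_swap1)
  then show ?case using Suc.IH[of "deriv F"] Suc.prems(1) Suc.prems(2)[of 0] by auto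
qed simp

section \<open>Upper bounds for zeros counted with multiplicity\<close>

text \<open>The weights \<open>m\<close> are only lower bounds for multiplicities and
  \<open>X\<close> is any finite set, so neither finiteness of the zero set nor of the
  multiplicities is presupposed. Admitting functions that are zero on all of \<open>S\<close> spares
  the Rolle steps any nondegeneracy hypothesis.\<close>

definition zeros_bounded :: "real set \<Rightarrow> (real \<Rightarrow> real) \<Rightarrow> nat \<Rightarrow> bool" where
  "zeros_bounded S F K \<longleftrightarrow> (\<forall>x\<in>S. F x = 0) \<or>
     (\<forall>X m. finite X \<longrightarrow> X \<subseteq> S \<longrightarrow> (\<forall>x\<in>X. vanishes_upto (m x) F x) \<longrightarrow> sum m X \<le> K)"

lemma zeros_boundedI:
  assumes "\<And>z X m. z \<in> S \<Longrightarrow> F z \<noteq> 0 \<Longrightarrow> finite X \<Longrightarrow> X \<subseteq> S \<Longrightarrow>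
    (\<And>x. x \<in> X \<Longrightarrow> vanishes_upto (m x) F x) \<Longrightarrow> sum m X \<le> K"
  shows "zeros_bounded S F K"
  unfolding zeros_bounded_def using assms by blast

lemma zeros_boundedD:
  assumes "zeros_bounded S F K" "z \<in> S" "F z \<noteq> 0" "finite X" "X \<subseteq> S"
    and "\<And>x. x \<in> X \<Longrightarrow> vanishes_upto (m x) F x"
  shows "sum m X \<le> K"
  using assms unfolding zeros_bounded_def by blast

lemma vanishes_upto_pos_imp: "vanishes_upto k F x \<Longrightarrow> k > 0 \<Longrightarrow> F x = 0"
  by (cases k) auto

text \<open>Points are added in increasing order, each giving a zero of \<open>F'\<close> strictly
  between it and the previous maximum. The bound by \<open>Max X\<close> keeps the new zero apart
  from the earlier ones; disjointness from \<open>X\<close> lets both kinds of zeros be counted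
  together.\<close>

lemma Rolle_finite_set:
  fixes F F' :: "real \<Rightarrow> real"
  assumes "finite X" "X \<noteq> {}" "X \<subseteq> S" "is_interval S" "\<And>x. x \<in> X \<Longrightarrow> F x = 0"
    and "\<And>x. x \<in> S \<Longrightarrow> (F has_real_derivative F' x) (at x)"
  shows "\<exists>Y. finite Y \<and> Y \<subseteq> S \<and> Y \<inter> X = {} \<and> Suc (card Y) = card X \<and> (\<forall>y\<in>Y. F' y = 0) \<and>
           (\<forall>y\<in>Y. y < Max X)"
  using assms(1-3,5)
proof (induction X rule: finite_linorder_max_induct)
  case (insert b A)
  show ?case
  proof (cases "A = {}")
    case False
    then obtain Y where Y: "finite Y" "Y \<subseteq> S" "Y \<inter> A = {}" "Suc (card Y) = card A"
      "\<forall>y\<in>Y. F' y = 0" "\<forall>y\<in>Y. y < Max A"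
    proof -
      have "A \<subseteq> S" "\<And>x. x \<in> A \<Longrightarrow> F x = 0" using insert.prems by auto
      from insert.IH[OF False this] that show ?thesis by blast
    qed
    let ?a = "Max A"
    have a: "?a \<in> A" "?a < b" using False insert.hyps by auto
    have sub: "{?a..b} \<subseteq> S"
    proof
      fix x assume "x \<in> {?a..b}"
      moreover have "?a \<in> S" "b \<in> S" using a insert.prems by auto
      ultimately show "x \<in> S" using assms(4) unfolding is_interval_1 by (meson atLeastAtMost_iff)
    qed
    have "\<exists>z>?a. z < b \<and> (F has_real_derivative 0) (at z)"
    proof (rule Rolle)
      show "?a < b" by (rule a)
      show "F ?a = F b" using insert.prems a by simp
      show "continuous_on {?a..b} F"
      proof (rule DERIV_continuous_on)
        show "(F has_real_derivative F' x) (at x within {?a..b})" if "x \<in> {?a..b}" for x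
          using that sub assms(6) has_field_derivative_at_within by blast
      qed
      show "F differentiable at x" if "?a < x" "x < b" for x
      proof -
        have "x \<in> S" using sub that by auto
        then show ?thesis using assms(6) real_differentiable_def by blast
      qed
    qed
    then obtain z where z: "?a < z" "z < b" "(F has_real_derivative 0) (at z)" by blast
    have "z \<in> S" using sub z by auto
    then have "F' z = 0" using assms(6) z(3) DERIV_unique by blast
    have zA: "z \<notin> A" "z \<notin> Y" using z(1) Y(6) insert.hyps(1) by (auto dest: Max_ge)
    have Mx: "Max (insert b A) = b" using insert.hyps by (intro Max_eqI) auto
    have b: "b \<notin> Y" "b \<notin> A" using Y(6) a(2) insert.hyps(2) less_asym by blast+
    show ?thesis
    proof (intro exI[of _ "insert z Y"] conjI)
      show "insert z Y \<inter> insert b A = {}" using Y(3) zA z(2) b by auto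
      show "Suc (card (insert z Y)) = card (insert b A)"
        using Y(1,4) zA(2) b(2) insert.hyps(1) by simp
      show "\<forall>y\<in>insert z Y. y < Max (insert b A)"
        using Y(6) z(2) a(2) less_trans unfolding Mx by blast
    qed (use Y(1,2,5) \<open>z \<in> S\<close> \<open>F' z = 0\<close> in simp_all)
  next
    case True
    then show ?thesis by (intro exI[of _ "{}"]) simp
  qed
qed simp

text \<open>Differentiation lowers each multiplicity by one, while Rolle supplies one new zero in
  each gap between distinct zeros; altogether exactly one zero is lost. The derivative
  \<open>F''\<close> is there so that a plain zero of \<open>F'\<close> counts as
  \<open>vanishes_upto 1\<close>.\<close>

lemma zeros_bounded_Rolle:
  assumes S: "is_interval S" "open S"
    and D: "\<And>x. x \<in> S \<Longrightarrow> (F has_real_derivative F' x) (at x)"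
    and D2: "\<And>x. x \<in> S \<Longrightarrow> (F' has_real_derivative F'' x) (at x)"
    and Z: "zeros_bounded S F' K"
  shows "zeros_bounded S F (Suc K)"
proof (cases "\<forall>x\<in>S. F' x = 0")
  case True
  have "\<exists>c. \<forall>x\<in>S. F x = c"
  proof (rule has_field_derivative_zero_constant)
    show "convex S" using S(1) by (rule is_interval_convex)
    show "(F has_real_derivative 0) (at x within S)" if "x \<in> S" for x
      using D[OF that] True that by (auto intro: has_field_derivative_at_within)
  qed
  then obtain c where c: "\<And>x. x \<in> S \<Longrightarrow> F x = c" by blast
  have "sum m X \<le> Suc K" if "c \<noteq> 0" "X \<subseteq> S" "\<forall>x\<in>X. vanishes_upto (m x) F x" for X m
  proof -
    have "m x = 0" if "x \<in> X" for x
      using vanishes_upto_pos_imp[of "m x" F x] c[of x] \<open>c \<noteq> 0\<close> \<open>X \<subseteq> S\<close> that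
        \<open>\<forall>x\<in>X. vanishes_upto (m x) F x\<close> by (metis gr0I subsetD)
    then show ?thesis by simp
  qed
  then show ?thesis using c unfolding zeros_bounded_def by blast
next
  case False
  have "sum m X \<le> Suc K" if X: "finite X" "X \<subseteq> S" "\<forall>x\<in>X. vanishes_upto (m x) F x" for X m
  proof -
    \<comment> \<open>Points of weight 0 need not be zeros of \<open>F\<close>, and
      \<open>m x - 1\<close> would truncate there.\<close>
    define X1 where "X1 = {x \<in> X. m x > 0}"
    have X1: "finite X1" "X1 \<subseteq> S" using X by (auto simp: X1_def)
    have sumX1: "sum m X = sum m X1"
      using X(1) by (intro sum.mono_neutral_right) (auto simp: X1_def)
    show ?thesis
    proof (cases "X1 = {}")
      case nonempty: False
      have "F x = 0" if "x \<in> X1" for x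
        using that X vanishes_upto_pos_imp by (auto simp: X1_def)
      then obtain Y where Y: "finite Y" "Y \<subseteq> S" "Y \<inter> X1 = {}" "Suc (card Y) = card X1"
        "\<forall>y\<in>Y. F' y = 0"
        using Rolle_finite_set[OF X1(1) nonempty X1(2) S(1) _ D] by blast
      \<comment> \<open>The weights for \<open>F'\<close>: one less at each old zero, and 1 at each
        Rolle point.\<close>
      define m' where "m' x = (if x \<in> X1 then m x - 1 else 1)" for x
      have ev: "\<forall>\<^sub>F y in nhds x. (F has_real_derivative F' y) (at y)" if "x \<in> S" for x
        using eventually_nhds_in_open[OF S(2) that] by eventually_elim (rule D)
      have van: "vanishes_upto (m' x) F' x" if "x \<in> X1 \<union> Y" for x
      proof (cases "x \<in> X1")
        case True
        then have "x \<in> S" "vanishes_upto (m x) F x" using X X1 by (auto simp: X1_def)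
        then show ?thesis
          using vanishes_upto_derivative[OF _ ev] True by (simp add: m'_def)
      next
        case False
        then have x: "x \<in> Y" using that by auto
        then have "\<forall>\<^sub>F y in nhds x. y \<in> S"
          using Y(2) by (intro eventually_nhds_in_open[OF S(2)]) auto
        then have "\<forall>\<^sub>F y in nhds x. (F' has_real_derivative F'' y) (at y)"
          by eventually_elim (rule D2)
        then have "vanishes_upto (Suc 0) F' x" using x Y(5) by (intro vanishes_uptoI) auto
        then show ?thesis using False by (simp add: m'_def)
      qed
      have "sum m' (X1 \<union> Y) \<le> K"
        using Z False X1 Y van unfolding zeros_bounded_def by (metis Un_least finite_UnI)
      also have "sum m' (X1 \<union> Y) = sum m' X1 + sum m' Y"
        using X1 Y by (intro sum.union_disjoint) auto
      also have "sum m' X1 = (\<Sum>x\<in>X1. m x - 1)" by (simp add: m'_def)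
      also have "sum m' Y = (\<Sum>y\<in>Y. 1)"
        using Y(3) by (intro sum.cong) (auto simp: m'_def)
      finally have "(\<Sum>x\<in>X1. m x - 1) + card Y \<le> K" by simp
      moreover have "(\<Sum>x\<in>X1. m x - 1) + card X1 = sum m X1"
      proof -
        have "(\<Sum>x\<in>X1. m x - 1) + card X1 = (\<Sum>x\<in>X1. (m x - 1) + 1)"
          by (simp only: sum.distrib card_eq_sum)
        also have "\<dots> = sum m X1" by (intro sum.cong) (auto simp: X1_def)
        finally show ?thesis .
      qed
      ultimately show ?thesis using sumX1 Y(4) by linarith
    qed (simp add: sumX1)
  qed
  then show ?thesis unfolding zeros_bounded_def by blast
qed

lemma zeros_bounded_derivative_chain:
  assumes "is_interval S" "open S"
    and D: "\<And>k x. x \<in> S \<Longrightarrow> (D k has_real_derivative D (Suc k) x) (at x)"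
    and "zeros_bounded S (D N) K"
  shows "zeros_bounded S (D 0) (K + N)"
  using assms(4)
proof (induction N arbitrary: K)
  case (Suc N)
  have "zeros_bounded S (D N) (Suc K)"
    using zeros_bounded_Rolle[OF assms(1,2) D D Suc.prems] .
  from Suc.IH[OF this] show ?case by simp
qed simp

lemma zeros_bounded_const: "zeros_bounded S (\<lambda>_. c) K"
proof (cases "c = 0")
  case False
  have "sum m X \<le> K" if "\<forall>x\<in>X. vanishes_upto (m x) (\<lambda>_. c) x" for X m
  proof -
    have "m x = 0" if "x \<in> X" for x
      using \<open>\<forall>x\<in>X. _\<close> that False vanishes_upto_pos_imp[of "m x" "\<lambda>_. c" x] by auto
    then show ?thesis by simp
  qed
  then show ?thesis unfolding zeros_bounded_def by blast
qed (simp add: zeros_bounded_def)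

lemma zeros_bounded_poly: "degree p \<le> d \<Longrightarrow> zeros_bounded UNIV (poly p) d"
proof (induction d arbitrary: p)
  case 0
  then obtain c where "p = [:c:]" by (metis degree_eq_zeroE le_0_eq)
  then show ?case using zeros_bounded_const[of UNIV c 0] by simp
next
  case (Suc d)
  then have "zeros_bounded UNIV (poly (pderiv p)) d" by (simp add: degree_pderiv)
  then show ?case by (rule zeros_bounded_Rolle[rotated 4]) (auto intro: poly_DERIV)
qed

lemma zeros_bounded_cong:
  assumes "open S" "\<And>x. x \<in> S \<Longrightarrow> F x = G x" "zeros_bounded S F K"
  shows "zeros_bounded S G K"
proof (rule zeros_boundedI)
  fix z X m assume z: "z \<in> S" "G z \<noteq> 0" and X: "finite X" "X \<subseteq> S"
    and van: "\<And>x. x \<in> X \<Longrightarrow> vanishes_upto (m x) G x"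
  show "sum m X \<le> K"
  proof (rule zeros_boundedD[OF assms(3) z(1) _ X])
    show "F z \<noteq> 0" using assms(2) z by simp
    fix x assume x: "x \<in> X"
    then have "\<forall>\<^sub>F y in nhds x. y \<in> S"
      using X(2) by (intro eventually_nhds_in_open[OF assms(1)]) auto
    then have "\<forall>\<^sub>F y in nhds x. G y = F y" by eventually_elim (simp add: assms(2))
    then show "vanishes_upto (m x) F x" using van[OF x] by (rule vanishes_upto_cong)
  qed
qed

text \<open>A smooth factor without zeros preserves every lower bound on multiplicities. This serves
  to clear denominators and to split off the factor \<open>u\<close>.\<close>

lemma zeros_bounded_mult:
  assumes "\<And>x. x \<in> S \<Longrightarrow> w x \<noteq> 0" "\<And>k x. x \<in> S \<Longrightarrow> diffble_upto k w x"
    and "zeros_bounded S (\<lambda>x. w x * F x) K"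
  shows "zeros_bounded S F K"
proof (rule zeros_boundedI)
  fix z X m assume z: "z \<in> S" "F z \<noteq> 0" and X: "finite X" "X \<subseteq> S"
    and van: "\<And>x. x \<in> X \<Longrightarrow> vanishes_upto (m x) F x"
  show "sum m X \<le> K"
  proof (rule zeros_boundedD[OF assms(3) z(1) _ X])
    show "w z * F z \<noteq> 0" using assms(1) z by simp
    show "vanishes_upto (m x) (\<lambda>x. w x * F x) x" if "x \<in> X" for x
      using that X(2) by (intro vanishes_upto_mult assms(2) van) auto
  qed
qed

text \<open>Composing with a smooth map cannot lower the order of a zero, so a zero of
  \<open>F\<close> at \<open>x\<close> gives one of \<open>F\<close> composed with \<open>g\<close>
  at \<open>g' x\<close>, of at least the same order. Only \<open>g\<close> has to be smooth; its
  right inverse \<open>g'\<close> merely transports points, injectively.\<close>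

lemma zeros_bounded_substitution:
  assumes g: "\<And>x. x \<in> T \<Longrightarrow> g' x \<in> S" "\<And>x. x \<in> T \<Longrightarrow> g (g' x) = x"
    and smooth: "\<And>k x. x \<in> S \<Longrightarrow> diffble_upto k g x"
    and "zeros_bounded S (\<lambda>x. F (g x)) K"
  shows "zeros_bounded T F K"
proof (rule zeros_boundedI)
  fix z X m assume z: "z \<in> T" "F z \<noteq> 0" and X: "finite X" "X \<subseteq> T"
    and van: "\<And>x. x \<in> X \<Longrightarrow> vanishes_upto (m x) F x"
  have gX: "g (g' x) = x" "g' x \<in> S" if "x \<in> X" for x using g X(2) that by auto
  have inj: "inj_on g' X" using gX(1) by (rule inj_on_inverseI)
  have "sum (\<lambda>y. m (g y)) (g' ` X) \<le> K"
  proof (rule zeros_boundedD[OF assms(4)])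
    show "g' z \<in> S" using g z by simp
    show "F (g (g' z)) \<noteq> 0" using g z by simp
    show "finite (g' ` X)" using X by simp
    show "g' ` X \<subseteq> S" using gX by auto
    fix y assume "y \<in> g' ` X"
    then obtain x where x: "x \<in> X" "y = g' x" by (elim imageE)
    then have "vanishes_upto (m (g y)) F (g y)" using gX[OF x(1)] van[OF x(1)] by simp
    then show "vanishes_upto (m (g y)) (\<lambda>x. F (g x)) y"
      by (rule vanishes_upto_compose) (use gX x in \<open>simp add: smooth\<close>)
  qed
  also have "sum (\<lambda>y. m (g y)) (g' ` X) = sum m X"
    by (subst sum.reindex[OF inj]) (simp add: gX)
  finally show "sum m X \<le> K" .
qed

text \<open>Reflection carries each positive zero to a negative one of the same multiplicity, so the
  weights count twice on the whole line.\<close>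

lemma zeros_bounded_even:
  assumes even: "\<And>x. F (- x) = F x" and "zeros_bounded UNIV F K"
  shows "zeros_bounded {0<..} F (K div 2)"
proof (rule zeros_boundedI)
  fix z X m assume z: "z \<in> {0<..}" "F z \<noteq> 0" and X: "finite X" "X \<subseteq> {0<..}"
    and van: "\<And>x. x \<in> X \<Longrightarrow> vanishes_upto (m x) F x"
  define Y where "Y = uminus ` X"
  have posX: "x > 0" if "x \<in> X" for x using X(2) that by auto
  have negY: "x < 0" if "x \<in> Y" for x using posX that by (auto simp: Y_def)
  have disj: "X \<inter> Y = {}" using posX negY less_asym by blast
  have "(\<Sum>y\<in>X \<union> Y. m \<bar>y\<bar>) \<le> K"
  proof (rule zeros_boundedD[OF assms(2) UNIV_I z(2)])
    fix y assume y: "y \<in> X \<union> Y"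
    show "vanishes_upto (m \<bar>y\<bar>) F y"
    proof (cases "y \<in> X")
      case True
      then show ?thesis using van[OF True] posX[OF True] by simp
    next
      case False
      then have "y \<in> Y" using y by simp
      then have "- y \<in> X" "\<bar>y\<bar> = - y" using negY[of y] by (auto simp: Y_def)
      \<comment> \<open>Negation is written as a polynomial function so that its smoothness is
        already available.\<close>
      then have "vanishes_upto (m \<bar>y\<bar>) F (poly [:0, -1:] y)" using van by simp
      then have "vanishes_upto (m \<bar>y\<bar>) (\<lambda>y. F (poly [:0, -1:] y)) y"
        by (rule vanishes_upto_compose) (rule diffble_upto_poly)
      then show ?thesis by (simp add: even)
    qed
  qed (use X in \<open>simp_all add: Y_def\<close>)
  also have "(\<Sum>y\<in>X \<union> Y. m \<bar>y\<bar>) = (\<Sum>y\<in>X. m \<bar>y\<bar>) + (\<Sum>y\<in>Y. m \<bar>y\<bar>)"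
    using X(1) disj by (intro sum.union_disjoint) (simp_all add: Y_def)
  also have "(\<Sum>y\<in>Y. m \<bar>y\<bar>) = (\<Sum>y\<in>X. m \<bar>y\<bar>)"
    unfolding Y_def by (subst sum.reindex) simp_all
  also have "(\<Sum>y\<in>X. m \<bar>y\<bar>) = sum m X"
    by (intro sum.cong refl arg_cong[of _ _ m] abs_of_pos posX)
  finally show "sum m X \<le> K div 2" by simp
qed

lemma one_plus_square_neq_0 [simp]: "1 + x\<^sup>2 \<noteq> (0::real)"
  by (metis add_pos_nonneg less_irrefl zero_le_power2 zero_less_one)

section \<open>Iterated derivatives of a polynomial times \<open>arctan\<close>\<close>

lemma DERIV_poly_over_power:
  "((\<lambda>x. poly p x / (1 + x\<^sup>2) ^ N) has_real_derivative
     poly (pderiv p * [:1, 0, 1:] - smult (2 * real N) (pCons 0 p)) x / (1 + x\<^sup>2) ^ Suc N) (at x)"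
proof (cases N)
  case 0
  have "1 + x * x \<noteq> 0" using one_plus_square_neq_0[of x] by (simp add: power2_eq_square)
  then have "(poly (pderiv p) x + x * (x * poly (pderiv p) x)) / (1 + x * x) = poly (pderiv p) x"
    by (simp add: field_simps)
  then show ?thesis using 0 poly_DERIV[of p x] by (simp add: power2_eq_square)
next
  case (Suc k)
  show ?thesis unfolding Suc
    by (rule derivative_eq_intros refl poly_DERIV | simp)+
       (simp add: divide_simps, simp add: power2_eq_square algebra_simps)
qed

text \<open>The index is shifted: this is the numerator of the derivative of \<open>arctan\<close>
  of order \<open>k + 1\<close>, over \<open>(1 + x\<^sup>2) ^ (k + 1)\<close>.\<close>

primrec arctan_deriv_num :: "nat \<Rightarrow> real poly" where
  "arctan_deriv_num 0 = 1"
| "arctan_deriv_num (Suc k) = pderiv (arctan_deriv_num k) * [:1, 0, 1:]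
     - smult (2 * real (Suc k)) (pCons 0 (arctan_deriv_num k))"

definition arctan_deriv :: "nat \<Rightarrow> real \<Rightarrow> real" where
  "arctan_deriv k x = (if k = 0 then arctan x else poly (arctan_deriv_num (k - 1)) x / (1 + x\<^sup>2) ^ k)"

lemma DERIV_arctan_deriv: "(arctan_deriv k has_real_derivative arctan_deriv (Suc k) x) (at x)"
proof (cases k)
  case 0
  have "(arctan has_real_derivative inverse (1 + x\<^sup>2)) (at x)" by (rule DERIV_arctan)
  then show ?thesis using 0 by (simp add: arctan_deriv_def[abs_def] inverse_eq_divide)
next
  case (Suc l)
  then show ?thesis using DERIV_poly_over_power[of "arctan_deriv_num l" "Suc l" x]
    by (simp add: arctan_deriv_def[abs_def])
qed

lemma degree_arctan_deriv_num: "degree (arctan_deriv_num k) \<le> k"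
proof (induction k)
  case (Suc k)
  let ?a = "arctan_deriv_num k"
  have "degree (pderiv ?a * [:1, 0, 1:]) \<le> Suc k"
  proof (cases "degree ?a = 0")
    case True
    then have "pderiv ?a = 0" by (simp add: pderiv_eq_0_iff)
    then show ?thesis by simp
  next
    case False
    have "degree (pderiv ?a * [:1, 0, 1:]) \<le> degree (pderiv ?a) + 2"
      by (rule order.trans[OF degree_mult_le]) simp
    then show ?thesis using False Suc by (simp add: degree_pderiv)
  qed
  moreover have "degree (smult (2 * real (Suc k)) (pCons 0 ?a)) \<le> Suc k"
    using Suc by (intro order.trans[OF degree_smult_le] order.trans[OF degree_pCons_le]) simp
  ultimately show ?case by (simp add: degree_diff_le del: smult_pCons mult_pCons_right)
qed simp

text \<open>Leibniz' rule alone only gives a numerator of degree \<open>2 * N - 2\<close>; the top half cancels.\<close>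
lemma poly_mult_arctan_derivs:
  assumes "degree R < N"
  shows "\<exists>D W. D 0 = (\<lambda>x. poly R x * arctan x) \<and>
           (\<forall>k x. (D k has_real_derivative D (Suc k) x) (at x)) \<and> degree W < N \<and>
           (\<forall>x. D N x = poly W x / (1 + x\<^sup>2) ^ N)"
  using assms
proof (induction N arbitrary: R)
  case (Suc N)
  obtain c R1 where R: "R = pCons c R1" by (cases R)
  show ?case
  proof (cases "N = 0")
    case True
    \<comment> \<open>Here \<open>R\<close> is the constant \<open>c\<close>. This case is separate
      because the induction hypothesis would need \<open>degree R1 < 0\<close>.\<close>
    then have "R1 = 0" using Suc.prems R by (auto split: if_splits)
    have "((\<lambda>x. c * arctan_deriv k x) has_real_derivative c * arctan_deriv (Suc k) x) (at x)" for k x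
      by (intro DERIV_cmult DERIV_arctan_deriv)
    then show ?thesis using R \<open>R1 = 0\<close> True
      by (intro exI[of _ "\<lambda>k x. c * arctan_deriv k x"] exI[of _ "[:c:]"])
         (auto simp: arctan_deriv_def)
  next
    case False
    have "degree R1 < N" using Suc.prems R False by (auto split: if_splits)
    from Suc.IH[OF this] obtain D W where D0: "D 0 = (\<lambda>x. poly R1 x * arctan x)"
      and D: "\<And>k x. (D k has_real_derivative D (Suc k) x) (at x)" and degW: "degree W < N"
      and DN: "\<And>x. D N x = poly W x / (1 + x\<^sup>2) ^ N" by blast
    \<comment> \<open>Leibniz' rule for \<open>x * (poly R1 x * arctan x) + c * arctan x\<close>:
      higher derivatives of \<open>x\<close> vanish, so two terms remain of the first product. At
      \<open>k = 0\<close> the truncated index \<open>k - 1\<close> is harmless, its coefficient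
      being 0.\<close>
    define E where "E k x = x * D k x + real k * D (k - 1) x + c * arctan_deriv k x" for k x
    have E: "(E k has_real_derivative E (Suc k) x) (at x)" for k x
      unfolding E_def[abs_def]
      by (cases k) (rule derivative_eq_intros D DERIV_arctan_deriv refl | simp add: algebra_simps)+
    \<comment> \<open>In the numerator of \<open>E (Suc N)\<close>, rewriting
      \<open>- 2 * N * x\<^sup>2 * W\<close> as
      \<open>- 2 * N * (1 + x\<^sup>2) * W + 2 * N * W\<close> collects the multiples of
      \<open>1 + x\<^sup>2\<close> into \<open>x * W' - (N - 1) * W\<close>, which is
      \<open>V\<close>. Its coefficient at \<open>x ^ (N - 1)\<close> cancels, and this saves the
      degree bound.\<close>
    define V where "V = pCons 0 (pderiv W) - smult (real N - 1) W"
    define U where "U = [:1, 0, 1:] * V + smult (2 * real N) W + smult c (arctan_deriv_num N)"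
    have coeff_V: "coeff V i = (real i - (real N - 1)) * coeff W i" for i
      by (cases i) (auto simp: V_def coeff_pderiv algebra_simps)
    have "coeff V i = 0" if "i \<ge> N - 1" for i
    proof (cases "i = N - 1")
      case True
      then show ?thesis using \<open>N \<noteq> 0\<close> by (simp add: coeff_V of_nat_diff)
    next
      case False
      then have "coeff W i = 0" using degW that by (intro coeff_eq_0) auto
      then show ?thesis by (simp add: coeff_V)
    qed
    then have V: "V = 0 \<or> degree V < N - 1" by (metis leading_coeff_0_iff not_le)
    have "degree ([:1, 0, 1:] * V) < Suc N"
    proof (cases "V = 0")
      case False
      have "degree ([:1, 0, 1:] * V) \<le> 2 + degree V"
        by (rule order.trans[OF degree_mult_le]) simp
      then show ?thesis using V False by simp
    qed simp
    moreover have "degree (smult (2 * real N) W) < Suc N" using degW by simp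
    moreover have "degree (smult c (arctan_deriv_num N)) < Suc N"
      using degree_arctan_deriv_num[of N] degree_smult_le[of c "arctan_deriv_num N"] by linarith
    ultimately have degU: "degree U < Suc N" unfolding U_def by (intro degree_add_less)
    have "E (Suc N) x = poly U x / (1 + x\<^sup>2) ^ Suc N" for x
    proof -
      let ?S = "poly (pderiv W * [:1, 0, 1:] - smult (2 * real N) (pCons 0 W)) x"
      have DSN: "D (Suc N) x = ?S / (1 + x\<^sup>2) ^ Suc N"
      proof (rule DERIV_unique[OF D])
        have "D N = (\<lambda>x. poly W x / (1 + x\<^sup>2) ^ N)" using DN by blast
        then show "(D N has_real_derivative poly (pderiv W * [:1, 0, 1:] - smult (2 * real N) (pCons 0 W)) x
              / (1 + x\<^sup>2) ^ Suc N) (at x)"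
          using DERIV_poly_over_power[of W N x] by (simp only:)
      qed
      have "D N x = (1 + x\<^sup>2) * poly W x / (1 + x\<^sup>2) ^ Suc N" using DN[of x] by simp
      then have "E (Suc N) x = (x * ?S + real (Suc N) * ((1 + x\<^sup>2) * poly W x)
          + c * poly (arctan_deriv_num N) x) / (1 + x\<^sup>2) ^ Suc N"
        unfolding E_def DSN arctan_deriv_def by (simp add: add_divide_distrib del: power_Suc)
      also have "x * ?S + real (Suc N) * ((1 + x\<^sup>2) * poly W x) + c * poly (arctan_deriv_num N) x = poly U x"
        unfolding U_def V_def by (simp add: power2_eq_square algebra_simps)
      finally show ?thesis .
    qed
    moreover have "E 0 = (\<lambda>x. poly R x * arctan x)"
      by (simp add: fun_eq_iff E_def arctan_deriv_def D0 R algebra_simps)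
    ultimately show ?thesis using E degU by blast
  qed
qed simp

text \<open>Differentiating the parity relation at order \<open>k\<close> in two ways changes its
  sign once.\<close>

lemma even_derivative_chain:
  assumes D: "\<And>k x. (D k has_real_derivative D (Suc k) x) (at x)" and "\<And>x. D 0 (- x) = D 0 x"
  shows "D k (- x) = (-1) ^ k * D k x"
proof (induction k arbitrary: x)
  case (Suc k)
  have "((\<lambda>x. D k (- x)) has_real_derivative - D (Suc k) (- x)) (at x)"
    using DERIV_chain2[of "D k" "D (Suc k) (- x)" uminus x "-1" UNIV] D[of k "- x"]
      DERIV_minus[OF DERIV_ident, of x UNIV] by simp
  moreover have "((\<lambda>x. D k (- x)) has_real_derivative (-1) ^ k * D (Suc k) x) (at x)"
    using DERIV_cmult[OF D[of k x], of "(-1) ^ k"] by (simp add: Suc.IH)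
  ultimately have "- D (Suc k) (- x) = (-1) ^ k * D (Suc k) x" by (rule DERIV_unique)
  then show ?case by simp
qed (use assms in simp)

lemma zeros_bounded_poly_plus_odd_poly_arctan:
  assumes P: "degree P \<le> 2 * n + 1" and R: "degree R \<le> 2 * n + 1" "\<And>x. poly R (- x) = - poly R x"
  shows "zeros_bounded {0<..} (\<lambda>x. poly P x + poly R x * arctan x) (3 * n + 2)"
proof -
  let ?N = "2 * n + 2"
  obtain D W where D0: "D 0 = (\<lambda>x. poly R x * arctan x)"
      and D: "\<And>k x. (D k has_real_derivative D (Suc k) x) (at x)" and degW: "degree W < ?N"
      and DN: "\<And>x. D ?N x = poly W x / (1 + x\<^sup>2) ^ ?N"
    using poly_mult_arctan_derivs[of R ?N] R(1) by auto
  have even: "poly W (- x) = poly W x" for x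
  proof -
    have "D ?N (- x) = (-1) ^ ?N * D ?N x"
      by (rule even_derivative_chain[of D, OF D]) (simp add: D0 R(2) arctan_minus)
    then show ?thesis unfolding DN by simp
  qed
  \<comment> \<open>Evenness halves the degree bound \<open>2 * n + 1\<close>, with rounding down to
    \<open>n\<close>.\<close>
  have "zeros_bounded {0<..} (poly W) ((2 * n + 1) div 2)"
    using degW by (intro zeros_bounded_even even zeros_bounded_poly) simp
  then have W: "zeros_bounded {0<..} (poly W) n" by simp
  have "zeros_bounded {0<..} (D ?N) n"
  proof (rule zeros_bounded_mult)
    have w: "poly ([:1, 0, 1:] ^ k) x = (1 + x\<^sup>2) ^ k" for x :: real and k
      by (simp add: poly_power power2_eq_square)
    show "poly ([:1, 0, 1:] ^ ?N) x \<noteq> 0" for x :: real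
      unfolding w by simp
    have "poly ([:1, 0, 1:] ^ ?N) x * D ?N x = poly W x" for x
      unfolding w DN by simp
    then show "zeros_bounded {0<..} (\<lambda>x. poly ([:1, 0, 1:] ^ ?N) x * D ?N x) n"
      using W by (simp only:)
  qed (rule diffble_upto_poly)
  \<comment> \<open>The order \<open>2 * n + 2\<close> exceeds the degree of \<open>P\<close>, so
    \<open>P\<close> contributes nothing to the last function of the chain, and Rolle's theorem can
    be iterated back to order 0.\<close>
  moreover define G where "G k x = poly ((pderiv ^^ k) P) x + D k x" for k x
  have "degree ((pderiv ^^ k) P) = degree P - k" for k
    by (induction k) (auto simp: degree_pderiv)
  from this[of "2 * n + 1"] have "degree ((pderiv ^^ (2 * n + 1)) P) = 0" using P by simp
  then have "(pderiv ^^ ?N) P = 0" by (simp add: pderiv_eq_0_iff)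
  then have "G ?N = D ?N" by (auto simp: G_def)
  ultimately have "zeros_bounded {0<..} (G ?N) n" by simp
  then have "zeros_bounded {0<..} (G 0) (n + ?N)"
  proof (rule zeros_bounded_derivative_chain[rotated 3])
    show "(G k has_real_derivative G (Suc k) x) (at x)" for k x
      unfolding G_def[abs_def] by (auto intro!: DERIV_add D poly_DERIV)
  qed auto
  then show ?thesis by (simp add: G_def[abs_def] D0)
qed

section \<open>The shape of the Melnikov function\<close>

inductive homogeneous :: "nat \<Rightarrow> (real \<Rightarrow> real \<Rightarrow> real) \<Rightarrow> bool" where
  monomial: "i + j = d \<Longrightarrow> homogeneous d (\<lambda>x y. x ^ i * y ^ j)"
| add: "homogeneous d F \<Longrightarrow> homogeneous d G \<Longrightarrow> homogeneous d (\<lambda>x y. F x y + G x y)"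
| scale: "homogeneous d F \<Longrightarrow> homogeneous d (\<lambda>x y. c * F x y)"

text \<open>On the unit circle the factor is 1, so forms of degree \<open>d\<close> can be regarded
  as forms of degree \<open>d + 2\<close> there. The reduction formulas for trigonometric integrals
  rely on this to match degrees.\<close>

lemma homogeneous_mult_square_radius:
  "homogeneous d F \<Longrightarrow> homogeneous (d + 2) (\<lambda>x y. (x\<^sup>2 + y\<^sup>2) * F x y)"
proof (induction rule: homogeneous.induct)
  case (monomial i j d)
  have "homogeneous (d + 2) (\<lambda>x y. x ^ (i + 2) * y ^ j + x ^ i * y ^ (j + 2))"
    using monomial by (intro homogeneous.intros) auto
  then show ?case by (simp add: power_add power2_eq_square algebra_simps)
next
  case (add d F G)
  then show ?case using homogeneous.add[OF add.IH] by (simp add: algebra_simps)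
next
  case (scale d F c)
  then show ?case using homogeneous.scale[OF scale.IH, of c] by (simp add: algebra_simps)
qed

lemma homogeneous_scaling: "homogeneous d F \<Longrightarrow> F (r * x) (r * y) = r ^ d * F x y"
  by (induction rule: homogeneous.induct) (auto simp: power_mult_distrib power_add algebra_simps)

text \<open>A monomial turns into a multiple of \<open>u ^ (i + 2 * j)\<close>, whose exponent lies
  between \<open>d\<close> and \<open>2 * d\<close>. Since \<open>d \<ge> 1\<close>, one factor
  \<open>u\<close> can be split off.\<close>

lemma homogeneous_on_parabola:
  assumes "homogeneous d F" "d \<ge> 1"
  shows "\<exists>P. degree P \<le> 2 * d - 1 \<and> (\<forall>u. F (\<sigma> * u) (\<tau> * u\<^sup>2) = u * poly P u)"
  using assms
proof (induction rule: homogeneous.induct)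
  case (monomial i j d)
  have "(\<sigma> * u) ^ i * (\<tau> * u\<^sup>2) ^ j = u * poly (monom (\<sigma> ^ i * \<tau> ^ j) (i + 2 * j - 1)) u" for u
  proof -
    have "u * (\<sigma> ^ i * \<tau> ^ j * u ^ (i + 2 * j - 1)) = \<sigma> ^ i * \<tau> ^ j * u ^ (Suc (i + 2 * j - 1))" by simp
    also have "Suc (i + 2 * j - 1) = i + 2 * j" using monomial by auto
    also have "\<sigma> ^ i * \<tau> ^ j * u ^ (i + 2 * j) = (\<sigma> * u) ^ i * (\<tau> * u\<^sup>2) ^ j"
      by (simp add: power_mult_distrib power_add power_mult)
    finally show ?thesis by (simp only: poly_monom)
  qed
  moreover have "degree (monom (\<sigma> ^ i * \<tau> ^ j) (i + 2 * j - 1)) \<le> 2 * d - 1"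
    using monomial by (intro order.trans[OF degree_monom_le]) simp
  ultimately show ?case by blast
next
  case (add d F G)
  then obtain P Q where "degree P \<le> 2 * d - 1" "\<forall>u. F (\<sigma> * u) (\<tau> * u\<^sup>2) = u * poly P u"
    "degree Q \<le> 2 * d - 1" "\<forall>u. G (\<sigma> * u) (\<tau> * u\<^sup>2) = u * poly Q u" by blast
  then show ?case by (intro exI[of _ "P + Q"]) (simp add: degree_add_le algebra_simps)
next
  case (scale d F c)
  then obtain P where "degree P \<le> 2 * d - 1" "\<forall>u. F (\<sigma> * u) (\<tau> * u\<^sup>2) = u * poly P u" by blast
  then show ?case
    by (intro exI[of _ "smult c P"]) (auto intro: order.trans[OF degree_smult_le])
qed

text \<open>The linear term \<open>\<kappa> * t\<close> is the only source of \<open>arctan\<close>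
  in the Melnikov function. Its absence for odd \<open>d\<close> means that it only ever meets
  integer powers of \<open>h\<close>.\<close>

definition trig_antiderivative :: "nat \<Rightarrow> (real \<Rightarrow> real) \<Rightarrow> (real \<Rightarrow> real) \<Rightarrow> bool" where
  "trig_antiderivative d f A \<longleftrightarrow> (\<exists>\<kappa> H. homogeneous d H \<and> (odd d \<longrightarrow> \<kappa> = 0) \<and>
     A = (\<lambda>t. \<kappa> * t + H (sin t) (cos t)) \<and> (\<forall>t. (A has_real_derivative f t) (at t)))"

lemma trig_antiderivative_add:
  assumes "trig_antiderivative d f A" "trig_antiderivative d g B"
  shows "trig_antiderivative d (\<lambda>t. f t + g t) (\<lambda>t. A t + B t)"
proof -
  obtain \<kappa> H \<mu> K where "homogeneous d H" "odd d \<longrightarrow> \<kappa> = 0" "A = (\<lambda>t. \<kappa> * t + H (sin t) (cos t))"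
    "\<And>t. (A has_real_derivative f t) (at t)" "homogeneous d K" "odd d \<longrightarrow> \<mu> = 0"
    "B = (\<lambda>t. \<mu> * t + K (sin t) (cos t))" "\<And>t. (B has_real_derivative g t) (at t)"
    using assms unfolding trig_antiderivative_def by blast
  then show ?thesis unfolding trig_antiderivative_def
    by (intro exI[of _ "\<kappa> + \<mu>"] exI[of _ "\<lambda>x y. H x y + K x y"] conjI allI DERIV_add homogeneous.add)
       (auto simp: algebra_simps)
qed

lemma trig_antiderivative_scale:
  assumes "trig_antiderivative d f A"
  shows "trig_antiderivative d (\<lambda>t. c * f t) (\<lambda>t. c * A t)"
proof -
  obtain \<kappa> H where "homogeneous d H" "odd d \<longrightarrow> \<kappa> = 0" "A = (\<lambda>t. \<kappa> * t + H (sin t) (cos t))"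
    "\<And>t. (A has_real_derivative f t) (at t)"
    using assms unfolding trig_antiderivative_def by blast
  then show ?thesis unfolding trig_antiderivative_def
    by (intro exI[of _ "c * \<kappa>"] exI[of _ "\<lambda>x y. c * H x y"] conjI allI DERIV_cmult homogeneous.scale)
       (auto simp: algebra_simps)
qed

lemma trig_antiderivative_raise:
  assumes "trig_antiderivative d f A"
  shows "trig_antiderivative (d + 2) f A"
proof -
  obtain \<kappa> H where H: "homogeneous d H" "odd d \<longrightarrow> \<kappa> = 0" "A = (\<lambda>t. \<kappa> * t + H (sin t) (cos t))"
    "\<And>t. (A has_real_derivative f t) (at t)"
    using assms unfolding trig_antiderivative_def by blast
  show ?thesis unfolding trig_antiderivative_def
    using H homogeneous_mult_square_radius[OF H(1)]
    by (intro exI[of _ \<kappa>] exI[of _ "\<lambda>x y. (x\<^sup>2 + y\<^sup>2) * H x y"]) simp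
qed

text \<open>The exponents \<open>a - 1\<close> and \<open>b - 1\<close> truncate only where their
  coefficients are 0.\<close>

lemma trig_antiderivative_monomial:
  assumes "a + b = d"
  shows "trig_antiderivative d
    (\<lambda>t. real a * sin t ^ (a - 1) * cos t ^ (b + 1) - real b * sin t ^ (a + 1) * cos t ^ (b - 1))
    (\<lambda>t. sin t ^ a * cos t ^ b)"
proof -
  have "((\<lambda>t. sin t ^ a * cos t ^ b) has_real_derivative
     real a * sin t ^ (a - 1) * cos t ^ (b + 1) - real b * sin t ^ (a + 1) * cos t ^ (b - 1)) (at t)" for t
    by (rule derivative_eq_intros refl | simp)+
  then show ?thesis unfolding trig_antiderivative_def using homogeneous.monomial[OF assms]
    by (intro exI[of _ 0] exI[of _ "\<lambda>x y. x ^ a * y ^ b"]) auto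
qed

lemma trig_antiderivative_cong:
  "trig_antiderivative d f A \<Longrightarrow> (\<And>t. f t = g t) \<Longrightarrow> trig_antiderivative d g A"
  by (metis ext)

text \<open>The classical reduction: with \<open>q = k + 2\<close>, differentiating
  \<open>sin t * cos t ^ (k + 1)\<close> gives
  \<open>q * cos t ^ q - (k + 1) * cos t ^ k\<close>.\<close>

lemma trig_antiderivative_cos_power: "\<exists>A. trig_antiderivative q (\<lambda>t. cos t ^ q) A"
proof (induction q rule: less_induct)
  case (less q)
  show ?case
  proof (cases "q = 0")
    case True
    \<comment> \<open>The antiderivative is \<open>t\<close> itself; the zero form is obtained by
      scaling a monomial with 0.\<close>
    have "homogeneous 0 (\<lambda>x y. 0 * (x ^ 0 * y ^ 0))" by (intro homogeneous.intros) simp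
    then have "trig_antiderivative q (\<lambda>t. cos t ^ q) (\<lambda>t. t)"
      unfolding trig_antiderivative_def using True
      by (intro exI[of _ 1] exI[of _ "\<lambda>x y. 0 * (x ^ 0 * y ^ 0)"]) auto
    then show ?thesis by blast
  next
    case False
    show ?thesis
    proof (cases "q = 1")
      case True
      have "trig_antiderivative q (\<lambda>t. cos t ^ q) (\<lambda>t. sin t ^ 1 * cos t ^ 0)"
        by (rule trig_antiderivative_cong[OF trig_antiderivative_monomial]) (use True in auto)
      then show ?thesis by blast
    next
      case q: False
      define k where "k = q - 2"
      have k: "q = k + 2" using \<open>q \<noteq> 0\<close> q by (simp add: k_def)
      obtain A where "trig_antiderivative k (\<lambda>t. cos t ^ k) A" using less[of k] k by auto
      then have A: "trig_antiderivative q (\<lambda>t. cos t ^ k) A"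
        unfolding k by (rule trig_antiderivative_raise)
      have M: "trig_antiderivative q
         (\<lambda>t. real 1 * sin t ^ (1 - 1) * cos t ^ ((k + 1) + 1) - real (k + 1) * sin t ^ (1 + 1) * cos t ^ ((k + 1) - 1))
         (\<lambda>t. sin t ^ 1 * cos t ^ (k + 1))"
        by (rule trig_antiderivative_monomial) (simp add: k)
      have "trig_antiderivative q (\<lambda>t. cos t ^ q)
        (\<lambda>t. (1 / real q) * (real (k + 1) * A t + sin t ^ 1 * cos t ^ (k + 1)))"
      proof (rule trig_antiderivative_cong[OF trig_antiderivative_scale[OF trig_antiderivative_add[OF
               trig_antiderivative_scale[OF A] M]]])
        show "(1 / real q) * (real (k + 1) * cos t ^ k + (real 1 * sin t ^ (1 - 1) * cos t ^ ((k + 1) + 1)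
             - real (k + 1) * sin t ^ (1 + 1) * cos t ^ ((k + 1) - 1))) = cos t ^ q" for t
        proof -
          have s2: "sin t * sin t = 1 - cos t * cos t"
            using sin_cos_squared_add[of t] by (simp add: power2_eq_square)
          have "(1 / real q) * (real (k + 1) * cos t ^ k + (real 1 * sin t ^ (1 - 1) * cos t ^ ((k + 1) + 1)
             - real (k + 1) * sin t ^ (1 + 1) * cos t ^ ((k + 1) - 1)))
             = (1 / real q) * (real (k + 1) * cos t ^ k + (cos t ^ q - real (k + 1) * (sin t * sin t) * cos t ^ k))"
            by (simp add: k)
          also have "real (k + 1) * cos t ^ k + (cos t ^ q - real (k + 1) * (sin t * sin t) * cos t ^ k)
              = real q * cos t ^ q"
            unfolding s2 by (simp add: k algebra_simps)
          finally show ?thesis using \<open>q \<noteq> 0\<close> by simp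
        qed
      qed
      then show ?thesis by blast
    qed
  qed
qed

text \<open>Integration by parts: with \<open>p = a + 1\<close>, the derivative of
  \<open>sin t ^ a * cos t ^ (q + 1)\<close> trades two powers of \<open>sin\<close> for two powers
  of \<open>cos\<close>, down to a pure power of \<open>cos\<close>.\<close>

lemma trig_antiderivative_exists: "\<exists>A. trig_antiderivative (p + q) (\<lambda>t. sin t ^ p * cos t ^ q) A"
proof (induction p arbitrary: q rule: less_induct)
  case (less p)
  show ?case
  proof (cases "p = 0")
    case True
    then show ?thesis using trig_antiderivative_cos_power[of q] by simp
  next
    case False
    then obtain a where a: "p = Suc a" by (cases p) auto
    have M: "trig_antiderivative (p + q)
       (\<lambda>t. real a * sin t ^ (a - 1) * cos t ^ ((q + 1) + 1) - real (q + 1) * sin t ^ (a + 1) * cos t ^ ((q + 1) - 1))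
       (\<lambda>t. sin t ^ a * cos t ^ (q + 1))"
      by (rule trig_antiderivative_monomial) (simp add: a)
    have "\<exists>A. trig_antiderivative (p + q) (\<lambda>t. real a * (sin t ^ (a - 1) * cos t ^ (q + 2))) A"
    proof (cases "a = 0")
      case True
      \<comment> \<open>For \<open>a = 0\<close> the integrand is zero; scaling \<open>M\<close> by
        0 provides its antiderivative.\<close>
      show ?thesis using trig_antiderivative_scale[OF M, of 0] True by auto
    next
      case False
      then have "(a - 1) + (q + 2) = p + q" using a by simp
      then show ?thesis using less[of "a - 1" "q + 2"] a trig_antiderivative_scale by (metis diff_le_self le_imp_less_Suc)
    qed
    then obtain A where A: "trig_antiderivative (p + q) (\<lambda>t. real a * (sin t ^ (a - 1) * cos t ^ (q + 2))) A" ..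
    have "trig_antiderivative (p + q) (\<lambda>t. sin t ^ p * cos t ^ q)
        (\<lambda>t. (1 / real (q + 1)) * (A t + (- 1) * (sin t ^ a * cos t ^ (q + 1))))"
      by (rule trig_antiderivative_cong[OF trig_antiderivative_scale[OF trig_antiderivative_add[OF A
               trig_antiderivative_scale[OF M]]]]) (simp add: a field_simps)
    then show ?thesis by blast
  qed
qed

section \<open>Switching points and the resulting form of the Melnikov function\<close>

lemma uh_pos: "h > 0 \<Longrightarrow> uh h > 0"
  by (simp add: uh_def)

lemma uh_quartic: "h > 0 \<Longrightarrow> (uh h) ^ 4 + (uh h)\<^sup>2 = h"
proof -
  assume h: "h > 0"
  define s where "s = sqrt (1 + 4 * h)"
  have s: "s\<^sup>2 = 1 + 4 * h" "s \<ge> 1" using h by (simp_all add: s_def)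
  have u2: "(uh h)\<^sup>2 = (s - 1) / 2" using s(2) by (simp add: uh_def s_def)
  have "(uh h) ^ 4 = ((uh h)\<^sup>2)\<^sup>2" by simp
  then show ?thesis using s(1) unfolding u2 by (simp add: power2_eq_square field_simps)
qed

text \<open>The inner radicand is the square of \<open>1 + 2 * u\<^sup>2\<close>.\<close>

lemma uh_of_quartic: "u > 0 \<Longrightarrow> uh (u\<^sup>2 + u ^ 4) = u"
proof -
  assume u: "u > 0"
  have "1 + 4 * (u\<^sup>2 + u ^ 4) = (1 + 2 * u\<^sup>2)\<^sup>2"
    by (simp add: power2_eq_square power4_eq_xxxx algebra_simps)
  then have "sqrt (1 + 4 * (u\<^sup>2 + u ^ 4)) = 1 + 2 * u\<^sup>2"
    by (simp only:) (simp add: add_nonneg_nonneg)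
  then show ?thesis using u by (simp add: uh_def)
qed

text \<open>Since \<open>h = u\<^sup>2 * (1 + u\<^sup>2)\<close>, the radius is
  \<open>u * sqrt (1 + u\<^sup>2)\<close>, which cancels the denominators of sine and cosine of
  \<open>arctan u\<close>.\<close>

lemma
  assumes "h > 0"
  shows thA_eq: "thA h = pi / 2 - arctan (uh h)"
    and sqrt_sin_arctan_uh: "sqrt h * sin (arctan (uh h)) = (uh h)\<^sup>2"
    and sqrt_cos_arctan_uh: "sqrt h * cos (arctan (uh h)) = uh h"
proof -
  let ?u = "uh h"
  have u: "?u > 0" using uh_pos assms .
  show "thA h = pi / 2 - arctan ?u"
    unfolding thA_def using arctan_inverse[of ?u] u by (simp only: sgn_pos less_imp_neq[OF u, symmetric] not_False_eq_True) (simp add: inverse_eq_divide)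
  have "h = ?u\<^sup>2 * (1 + ?u\<^sup>2)"
    using uh_quartic[OF assms] by (simp add: power2_eq_square power4_eq_xxxx algebra_simps)
  then have r: "sqrt h = ?u * sqrt (1 + ?u\<^sup>2)"
    using u by (metis abs_of_pos real_sqrt_abs real_sqrt_mult)
  have nz: "sqrt (1 + ?u\<^sup>2) \<noteq> 0" by simp
  show "sqrt h * sin (arctan ?u) = ?u\<^sup>2" "sqrt h * cos (arctan ?u) = ?u"
    unfolding r using nz by (simp_all add: sin_arctan cos_arctan power2_eq_square)
qed

text \<open>Treats all five integration limits alike. The constants do not depend on
  \<open>h\<close>; the signs \<open>\<sigma>\<close> and \<open>\<tau>\<close> select the switching
  point, and \<open>c1\<close> is the sign with which \<open>arctan u\<close> enters the
  angle.\<close>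

definition arc_endpoint :: "(real \<Rightarrow> real) \<Rightarrow> bool" where
  "arc_endpoint e \<longleftrightarrow> (\<exists>c0 c1 \<sigma> \<tau>. \<forall>h>0. e h = c0 + c1 * arctan (uh h) \<and>
     sqrt h * sin (e h) = \<sigma> * uh h \<and> sqrt h * cos (e h) = \<tau> * (uh h)\<^sup>2)"

lemma arc_endpoints:
  "arc_endpoint thA" "arc_endpoint (\<lambda>h. pi - thA h)" "arc_endpoint (\<lambda>h. pi + thA h)"
  "arc_endpoint (\<lambda>h. 2 * pi - thA h)" "arc_endpoint (\<lambda>h. 2 * pi + thA h)"
proof -
  note facts = thA_eq sqrt_sin_arctan_uh sqrt_cos_arctan_uh
  have A: "sqrt h * sin (thA h) = uh h" "sqrt h * cos (thA h) = (uh h)\<^sup>2" if "h > 0" for h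
    using facts[OF that] by (simp_all add: sin_diff cos_diff)
  show "arc_endpoint thA" unfolding arc_endpoint_def
    by (intro exI[of _ "pi / 2"] exI[of _ "-1"] exI[of _ 1] exI[of _ 1]) (auto simp: A, auto simp: thA_eq)
  show "arc_endpoint (\<lambda>h. pi - thA h)" unfolding arc_endpoint_def
    by (intro exI[of _ "pi / 2"] exI[of _ "1"] exI[of _ 1] exI[of _ "-1"]) (auto simp: A, auto simp: thA_eq)
  show "arc_endpoint (\<lambda>h. pi + thA h)" unfolding arc_endpoint_def
    by (intro exI[of _ "3 * pi / 2"] exI[of _ "-1"] exI[of _ "-1"] exI[of _ "-1"]) (auto simp: A, auto simp: thA_eq)
  show "arc_endpoint (\<lambda>h. 2 * pi - thA h)" unfolding arc_endpoint_def
    by (intro exI[of _ "3 * pi / 2"] exI[of _ "1"] exI[of _ "-1"] exI[of _ "1"]) (auto simp: A sin_diff cos_diff, auto simp: thA_eq)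
  show "arc_endpoint (\<lambda>h. 2 * pi + thA h)" unfolding arc_endpoint_def
    by (intro exI[of _ "5 * pi / 2"] exI[of _ "-1"] exI[of _ "1"] exI[of _ "1"]) (auto simp: A sin_add cos_add, auto simp: thA_eq)
qed

text \<open>The \<open>arctan\<close> coefficient is kept as a polynomial in \<open>h\<close>,
  because even powers of \<open>sqrt h\<close> are powers of \<open>h\<close>. With
  \<open>h = u\<^sup>2 + u ^ 4\<close> it becomes \<open>u\<close> times an odd polynomial in
  \<open>u\<close>.\<close>

definition melnikov_form :: "nat \<Rightarrow> (real \<Rightarrow> real) \<Rightarrow> bool" where
  "melnikov_form n F \<longleftrightarrow> (\<exists>P Q. degree P \<le> 2 * n + 1 \<and> degree Q \<le> (n - 1) div 2 \<and>
     (\<forall>h>0. F h = uh h * poly P (uh h) + h * poly Q h * arctan (uh h)))"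

lemma melnikov_form_add:
  assumes "melnikov_form n F" "melnikov_form n G"
  shows "melnikov_form n (\<lambda>h. F h + G h)"
proof -
  obtain P Q P' Q' where "degree P \<le> 2 * n + 1" "degree Q \<le> (n - 1) div 2"
    "\<forall>h>0. F h = uh h * poly P (uh h) + h * poly Q h * arctan (uh h)"
    "degree P' \<le> 2 * n + 1" "degree Q' \<le> (n - 1) div 2"
    "\<forall>h>0. G h = uh h * poly P' (uh h) + h * poly Q' h * arctan (uh h)"
    using assms unfolding melnikov_form_def by blast
  then show ?thesis unfolding melnikov_form_def
    by (intro exI[of _ "P + P'"] exI[of _ "Q + Q'"]) (simp add: degree_add_le algebra_simps)
qed

lemma melnikov_form_scale:
  assumes "melnikov_form n F"
  shows "melnikov_form n (\<lambda>h. c * F h)"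
proof -
  obtain P Q where "degree P \<le> 2 * n + 1" "degree Q \<le> (n - 1) div 2"
    "\<forall>h>0. F h = uh h * poly P (uh h) + h * poly Q h * arctan (uh h)"
    using assms unfolding melnikov_form_def by blast
  then show ?thesis unfolding melnikov_form_def
    by (intro exI[of _ "smult c P"] exI[of _ "smult c Q"])
       (auto simp: algebra_simps intro: order.trans[OF degree_smult_le])
qed

lemma melnikov_form_sum:
  "finite I \<Longrightarrow> (\<And>i. i \<in> I \<Longrightarrow> melnikov_form n (F i)) \<Longrightarrow> melnikov_form n (\<lambda>h. \<Sum>i\<in>I. F i h)"
proof (induction I rule: finite_induct)
  case empty
  show ?case unfolding melnikov_form_def by (intro exI[of _ 0]) simp
qed (simp add: melnikov_form_add)

lemma melnikov_form_cong:
  "melnikov_form n F \<Longrightarrow> (\<And>h. h > 0 \<Longrightarrow> F h = G h) \<Longrightarrow> melnikov_form n G"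
  unfolding melnikov_form_def by metis

lemma melnikov_form_endpoint:
  assumes A: "trig_antiderivative d f A" and d: "1 \<le> d" "d \<le> n + 1" and e: "arc_endpoint e"
  shows "melnikov_form n (\<lambda>h. sqrt h ^ d * A (e h))"
proof -
  obtain \<kappa> H where H: "homogeneous d H" "odd d \<longrightarrow> \<kappa> = 0" "A = (\<lambda>t. \<kappa> * t + H (sin t) (cos t))"
    using A unfolding trig_antiderivative_def by blast
  obtain c0 c1 \<sigma> \<tau> where e: "\<And>h. h > 0 \<Longrightarrow> e h = c0 + c1 * arctan (uh h)"
    "\<And>h. h > 0 \<Longrightarrow> sqrt h * sin (e h) = \<sigma> * uh h" "\<And>h. h > 0 \<Longrightarrow> sqrt h * cos (e h) = \<tau> * (uh h)\<^sup>2"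
    using e unfolding arc_endpoint_def by blast
  obtain P where P: "degree P \<le> 2 * d - 1" "\<And>u. H (\<sigma> * u) (\<tau> * u\<^sup>2) = u * poly P u"
    using homogeneous_on_parabola[OF H(1) d(1)] by blast
  have HP: "sqrt h ^ d * H (sin (e h)) (cos (e h)) = uh h * poly P (uh h)" if "h > 0" for h
    using homogeneous_scaling[OF H(1), of "sqrt h" "sin (e h)" "cos (e h)"] e[OF that] P(2) by simp
  show ?thesis
  proof (cases "odd d")
    case True
    then show ?thesis unfolding melnikov_form_def using H HP P(1) d(2)
      by (intro exI[of _ P] exI[of _ 0]) auto
  next
    case False
    \<comment> \<open>Even \<open>d\<close> with \<open>2 \<le> d \<le> n + 1\<close> leaves
      \<open>h ^ (k + 1)\<close> with \<open>k \<le> (n - 1) div 2\<close>, which is the degree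
      bound on \<open>Q\<close>.\<close>
    then obtain k where k: "d = 2 * Suc k" using d(1) by (metis Suc_pred evenE mult_0_right not_gr0 not_one_le_zero)
    have hd: "sqrt h ^ d = h * h ^ k" if "h > 0" for h using that by (simp add: k power_mult)
    \<comment> \<open>The constant part \<open>c0\<close> of the angle contributes a multiple of
      \<open>h ^ (k + 1)\<close> without \<open>arctan\<close>, which equals \<open>u * U(u)\<close>
      and must be absorbed into \<open>P\<close>. The degree of \<open>U\<close> is
      \<open>4 * k + 3 = 2 * d - 1\<close>.\<close>
    define U :: "real poly" where "U = monom 1 (2 * k + 1) * [:1, 0, 1:] ^ Suc k"
    have U: "h * h ^ k = uh h * poly U (uh h)" if "h > 0" for h
    proof -
      have "h = (uh h)\<^sup>2 * (1 + (uh h)\<^sup>2)"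
        using uh_quartic[OF that] by (simp add: power2_eq_square power4_eq_xxxx algebra_simps)
      then have "h ^ Suc k = ((uh h)\<^sup>2 * (1 + (uh h)\<^sup>2)) ^ Suc k" by (simp only:)
      also have "\<dots> = uh h * poly U (uh h)"
        unfolding U_def by (simp add: poly_monom poly_power power_mult_distrib power_mult[symmetric])
          (simp add: power2_eq_square algebra_simps)
      finally show ?thesis by simp
    qed
    have "degree U \<le> 2 * n + 1"
    proof -
      have "degree U \<le> degree (monom (1::real) (2 * k + 1)) + degree ([:1, 0, 1::real:] ^ Suc k)"
        unfolding U_def by (rule degree_mult_le)
      also have "degree (monom (1::real) (2 * k + 1)) = 2 * k + 1" by (simp add: degree_monom_eq)
      also have "degree ([:1, 0, 1::real:] ^ Suc k) \<le> degree [:1, 0, 1::real:] * Suc k"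
        by (rule degree_power_le)
      finally show ?thesis using k d(2) by simp
    qed
    moreover have "degree P \<le> 2 * n + 1" using P(1) d(2) by simp
    moreover have "k \<le> (n - 1) div 2" using k d(2) by simp
    moreover have "sqrt h ^ d * A (e h) = uh h * poly (smult (\<kappa> * c0) U + P) (uh h)
        + h * poly (monom (\<kappa> * c1) k) h * arctan (uh h)" if "h > 0" for h
    proof -
      have "sqrt h ^ d * A (e h) = (h * h ^ k) * \<kappa> * c0 + (h * h ^ k) * \<kappa> * c1 * arctan (uh h)
          + sqrt h ^ d * H (sin (e h)) (cos (e h))"
        using e(1)[OF that] by (simp add: H(3) algebra_simps hd[OF that, symmetric])
      then show ?thesis unfolding HP[OF that] using U[OF that]
        by (simp add: poly_monom algebra_simps)
    qed
    ultimately show ?thesis unfolding melnikov_form_def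
      by (intro exI[of _ "smult (\<kappa> * c0) U + P"] exI[of _ "monom (\<kappa> * c1) k"] conjI allI impI)
         (auto intro!: degree_add_le order.trans[OF degree_smult_le] order.trans[OF degree_monom_le])
  qed
qed

lemma integral_eq_antiderivative:
  fixes A :: "real \<Rightarrow> real"
  assumes "a \<le> b" "\<And>t. (A has_real_derivative f t) (at t)"
  shows "integral {a..b} f = A b - A a"
proof -
  have "(f has_integral (A b - A a)) {a..b}"
    using assms by (intro fundamental_theorem_of_calculus)
      (auto simp: has_real_derivative_iff_has_vector_derivative[symmetric] intro: has_field_derivative_at_within)
  then show ?thesis by (rule integral_unique)
qed

lemma melnikov_form_arc_int:
  assumes "arc_endpoint e0" "arc_endpoint e1" "\<And>h. h > 0 \<Longrightarrow> e0 h \<le> e1 h"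
  shows "melnikov_form n (\<lambda>h. arc_int (poly2 n a) (poly2 n b) h (e0 h) (e1 h))"
proof -
  obtain A where A: "\<And>p q. trig_antiderivative (p + q) (\<lambda>t. sin t ^ p * cos t ^ q) (A p q)"
    using trig_antiderivative_exists by metis
  \<comment> \<open>An antiderivative assembled monomial by monomial. The line element raises the
    power of \<open>cos\<close> in the terms of \<open>b\<close> and that of \<open>sin\<close> in
    the terms of \<open>a\<close>, so the degrees \<open>i + j + 1\<close> range from 1 to
    \<open>n + 1\<close>.\<close>
  define B where "B h t = (\<Sum>i\<le>n. \<Sum>j\<le>n - i. b i j * (sqrt h ^ (i + Suc j) * A i (Suc j) t)
      + a i j * (sqrt h ^ (Suc i + j) * A (Suc i) j t))" for h t
  let ?f = "\<lambda>h t. poly2 n b (sqrt h * sin t) (sqrt h * cos t) * (sqrt h * cos t)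
                - poly2 n a (sqrt h * sin t) (sqrt h * cos t) * (- (sqrt h * sin t))"
  have "(A p q has_real_derivative sin t ^ p * cos t ^ q) (at t)" for p q t
    using A[of p q] unfolding trig_antiderivative_def by blast
  then have "(B h has_real_derivative (\<Sum>i\<le>n. \<Sum>j\<le>n - i. b i j * (sqrt h ^ (i + Suc j) * (sin t ^ i * cos t ^ Suc j))
      + a i j * (sqrt h ^ (Suc i + j) * (sin t ^ Suc i * cos t ^ j)))) (at t)" for h t
    unfolding B_def[abs_def] by (intro DERIV_sum DERIV_add DERIV_cmult)
  also have "(\<lambda>h t. (\<Sum>i\<le>n. \<Sum>j\<le>n - i. b i j * (sqrt h ^ (i + Suc j) * (sin t ^ i * cos t ^ Suc j))
      + a i j * (sqrt h ^ (Suc i + j) * (sin t ^ Suc i * cos t ^ j)))) = ?f"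
    by (intro ext)
       (simp add: poly2_def sum_distrib_left sum_distrib_right sum.distrib sum_negf power_mult_distrib power_add mult_ac)
  finally have B: "(B h has_real_derivative ?f h t) (at t)" for h t .
  have "arc_int (poly2 n a) (poly2 n b) h (e0 h) (e1 h) = B h (e1 h) + (- 1) * B h (e0 h)" if "h > 0" for h
  proof -
    show ?thesis unfolding arc_int_def integral_eq_antiderivative[OF assms(3)[OF that] B] by simp
  qed
  note arc = this
  have endpoint: "melnikov_form n (\<lambda>h. B h (e h))" if "arc_endpoint e" for e
    unfolding B_def
    by (intro melnikov_form_sum melnikov_form_add melnikov_form_scale melnikov_form_endpoint[OF A] that) auto
  show ?thesis
    by (rule melnikov_form_cong[OF melnikov_form_add[OF endpoint[OF assms(2)]
          melnikov_form_scale[OF endpoint[OF assms(1)], of "- 1"]]]) (rule arc[symmetric])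
qed

lemma thA_bounds: "h > 0 \<Longrightarrow> 0 < thA h \<and> thA h < pi / 2"
  using uh_pos[of h] arctan_ubound[of "uh h"] by (simp add: thA_eq zero_less_arctan_iff)

lemma melnikov_form_melnikov: "melnikov_form n (melnikov n a b)"
  unfolding melnikov_def[abs_def] Let_def
  by (intro melnikov_form_add melnikov_form_arc_int arc_endpoints) (use thA_bounds in \<open>fastforce+\<close>)

section \<open>Counting the zeros of the Melnikov function\<close>

lemma diffble_upto_powr_compose:
  assumes "diffble_upto k G x" "G x > 0"
  shows "diffble_upto k (\<lambda>y. G y powr a) x"
  using diffble_upto_compose[of k "\<lambda>z. 1 * z powr a" G x] diffble_upto_powr[of "G x" k 1 a] assms
  by simp

lemma diffble_upto_uh:
  assumes "h > 0"
  shows "diffble_upto k uh h"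
proof -
  \<comment> \<open>Both square roots in \<open>uh\<close> are written as powers with exponent
    \<open>1 / 2\<close> of functions positive near \<open>h\<close>, so smoothness follows by
    composition.\<close>
  let ?s = "\<lambda>y::real. poly [:1, 4:] y powr (1 / 2)"
  let ?t = "\<lambda>y. poly [:- 1 / 2, 1 / 2:] (?s y)"
  have s: "?s y = sqrt (1 + 4 * y)" if "y > 0" for y
    using that by (simp add: powr_half_sqrt mult.commute)
  then have t: "?t y = (sqrt (1 + 4 * y) - 1) / 2" if "y > 0" for y
    using that by (simp add: field_simps)
  have t_pos: "?t y > 0" if "y > 0" for y using that unfolding t[OF that] by simp
  have "diffble_upto k ?s h"
    by (rule diffble_upto_powr_compose[OF diffble_upto_poly]) (use assms in simp)
  then have "diffble_upto k ?t h"
    using diffble_upto_compose[of k "poly [:- 1 / 2, 1 / 2:]" ?s h] by simp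
  then have g: "diffble_upto k (\<lambda>y. ?t y powr (1 / 2)) h"
    using t_pos[OF assms] by (rule diffble_upto_powr_compose)
  have "\<forall>\<^sub>F y in nhds h. y \<in> {0<..}" using assms by (intro eventually_nhds_in_open) auto
  then have "\<forall>\<^sub>F y in nhds h. ?t y powr (1 / 2) = uh y"
  proof eventually_elim
    case (elim y)
    then have "y > 0" by simp
    then show ?case using t_pos[of y] by (simp only: powr_half_sqrt less_imp_le uh_def t)
  qed
  then show ?thesis using g by (rule diffble_upto_cong)
qed

lemma melnikov_form_diffble_upto:
  assumes "melnikov_form n F" "h > 0"
  shows "diffble_upto k F h"
proof -
  obtain P Q where F: "\<And>h. h > 0 \<Longrightarrow> F h = uh h * poly P (uh h) + h * poly Q h * arctan (uh h)"
    using assms unfolding melnikov_form_def by blast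
  have "\<forall>\<^sub>F y in nhds h. y \<in> {0<..}" using assms by (intro eventually_nhds_in_open) auto
  then have "\<forall>\<^sub>F h in nhds h. uh h * poly P (uh h) + h * poly Q h * arctan (uh h) = F h"
    by eventually_elim (simp add: F)
  moreover have "diffble_upto k (\<lambda>h. uh h * poly P (uh h) + h * poly Q h * arctan (uh h)) h"
    using diffble_upto_uh[OF assms(2)] diffble_upto_compose[of k "poly P" uh h]
      diffble_upto_compose[of k arctan uh h]
    by (simp add: diffble_upto_add diffble_upto_mult)
  ultimately show ?thesis by (rule diffble_upto_cong)
qed

text \<open>Substituting \<open>h = u\<^sup>2 + u ^ 4\<close> and dividing by \<open>u > 0\<close>
  preserves bounds on zeros with multiplicity.\<close>

lemma zeros_bounded_melnikov_form:
  assumes F: "\<And>h. h > 0 \<Longrightarrow> F h = uh h * poly P (uh h) + h * poly Q h * arctan (uh h)"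
    and Z: "zeros_bounded {0<..} (\<lambda>u. poly P u + (u + u ^ 3) * poly Q (u\<^sup>2 + u ^ 4) * arctan u) K"
  shows "zeros_bounded {0<..} F K"
proof (rule zeros_bounded_substitution)
  let ?g = "poly [:0, 0, 1, 0, 1:] :: real \<Rightarrow> real"
  have g: "?g u = u\<^sup>2 + u ^ 4" for u by (simp add: power2_eq_square power4_eq_xxxx algebra_simps)
  have g_pos: "u\<^sup>2 + u ^ 4 > 0" if "u > 0" for u :: real using that by (simp add: add_pos_pos)
  show "uh h \<in> {0<..}" if "h \<in> {0<..}" for h using that uh_pos by simp
  show "?g (uh h) = h" if "h \<in> {0<..}" for h using uh_quartic[of h] that unfolding g by simp
  show "diffble_upto k ?g u" for k u by (rule diffble_upto_poly)
  show "zeros_bounded {0<..} (\<lambda>u. F (?g u)) K"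
  proof (rule zeros_bounded_mult)
    show "1 * u powr (-1) \<noteq> 0" if "u \<in> {0<..}" for u :: real using that by simp
    show "diffble_upto k (\<lambda>u. 1 * u powr (-1)) u" if "u \<in> {0<..}" for k u
      using that by (intro diffble_upto_powr) simp
    show "zeros_bounded {0<..} (\<lambda>u. 1 * u powr (-1) * F (?g u)) K"
    proof (rule zeros_bounded_cong[OF _ _ Z])
      fix u :: real assume "u \<in> {0<..}"
      then have u: "u > 0" by simp
      have "F (?g u) = u * (poly P u + (u + u ^ 3) * poly Q (u\<^sup>2 + u ^ 4) * arctan u)"
        unfolding g F[OF g_pos[OF u]] uh_of_quartic[OF u]
        by (simp add: power2_eq_square power3_eq_cube power4_eq_xxxx algebra_simps)
      then show "poly P u + (u + u ^ 3) * poly Q (u\<^sup>2 + u ^ 4) * arctan u = 1 * u powr (-1) * F (?g u)"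
        using u by (simp only: powr_minus_divide powr_one) simp
    qed simp
  qed
qed

lemma zeros_bounded_melnikov:
  assumes "n \<ge> 1"
  shows "zeros_bounded {0<..} (melnikov n a b) (3 * n + 2)"
proof -
  obtain P Q where P: "degree P \<le> 2 * n + 1" and Q: "degree Q \<le> (n - 1) div 2"
    and M: "\<And>h. h > 0 \<Longrightarrow> melnikov n a b h = uh h * poly P (uh h) + h * poly Q h * arctan (uh h)"
    using melnikov_form_melnikov[of n a b] unfolding melnikov_form_def by blast
  define R where "R = [:0, 1, 0, 1:] * pcompose Q [:0, 0, 1, 0, 1:]"
  have R: "poly R u = (u + u ^ 3) * poly Q (u\<^sup>2 + u ^ 4)" for u
    by (simp add: R_def poly_pcompose power2_eq_square power3_eq_cube power4_eq_xxxx algebra_simps)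
  have "degree R \<le> 3 + degree (pcompose Q [:0, 0, 1, 0, 1:])"
    unfolding R_def by (rule order.trans[OF degree_mult_le]) simp
  also have "degree (pcompose Q [:0, 0, 1, 0, 1:]) = degree Q * 4" by (simp add: degree_pcompose)
  \<comment> \<open>The bound is
    \<open>3 + 4 * ((n - 1) div 2) \<le> 3 + 2 * (n - 1)\<close>.\<close>
  finally have "degree R \<le> 2 * n + 1" using Q assms by linarith
  moreover have "poly R (- u) = - poly R u" for u unfolding R by (simp add: algebra_simps)
  ultimately show ?thesis
    using zeros_bounded_poly_plus_odd_poly_arctan[OF P, of R]
    by (intro zeros_bounded_melnikov_form[OF M]) (simp_all only: R)
qed

section \<open>The sharper upper bound for \<open>n = 1\<close>\<close>

lemma cubic_arctan_derivatives:
  fixes u :: real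
  shows "((\<lambda>u. (u + u ^ 3) * arctan u) has_real_derivative ((1 + 3 * u\<^sup>2) * arctan u + u)) (at u)"
    and "((\<lambda>u. (1 + 3 * u\<^sup>2) * arctan u + u) has_real_derivative (6 * u * arctan u + 4 - 2 / (1 + u\<^sup>2))) (at u)"
    and "((\<lambda>u. 6 * u * arctan u + 4 - 2 / (1 + u\<^sup>2)) has_real_derivative
           (6 * arctan u + 6 * u / (1 + u\<^sup>2) + 4 * u / (1 + u\<^sup>2)\<^sup>2)) (at u)"
    and "((\<lambda>u. 6 * arctan u + 6 * u / (1 + u\<^sup>2) + 4 * u / (1 + u\<^sup>2)\<^sup>2) has_real_derivative
           (16 / (1 + u\<^sup>2) ^ 3)) (at u)"
    and "((\<lambda>u. 16 / (1 + u\<^sup>2) ^ 3) has_real_derivative (- 96 * u / (1 + u\<^sup>2) ^ 4)) (at u)"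
proof -
  have nz: "1 + u\<^sup>2 \<noteq> 0" by simp
  have nz': "1 + u * u \<noteq> 0" using nz by (simp add: power2_eq_square)
  show "((\<lambda>u. (u + u ^ 3) * arctan u) has_real_derivative ((1 + 3 * u\<^sup>2) * arctan u + u)) (at u)"
    by (rule derivative_eq_intros refl | simp)+ (use nz' in \<open>simp add: field_simps power2_eq_square power3_eq_cube\<close>)
  show "((\<lambda>u. (1 + 3 * u\<^sup>2) * arctan u + u) has_real_derivative (6 * u * arctan u + 4 - 2 / (1 + u\<^sup>2))) (at u)"
    by (rule derivative_eq_intros refl | simp)+ (use nz' in \<open>simp add: field_simps power2_eq_square\<close>)
  show "((\<lambda>u. 6 * u * arctan u + 4 - 2 / (1 + u\<^sup>2)) has_real_derivative
           (6 * arctan u + 6 * u / (1 + u\<^sup>2) + 4 * u / (1 + u\<^sup>2)\<^sup>2)) (at u)"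
    by (rule derivative_eq_intros refl | simp)+ (use nz' in \<open>simp add: field_simps power2_eq_square\<close>)
  show "((\<lambda>u. 6 * arctan u + 6 * u / (1 + u\<^sup>2) + 4 * u / (1 + u\<^sup>2)\<^sup>2) has_real_derivative
           (16 / (1 + u\<^sup>2) ^ 3)) (at u)"
  proof (rule DERIV_cong)
    let ?q = "1 + u\<^sup>2"
    show "((\<lambda>u. 6 * arctan u + 6 * u / (1 + u\<^sup>2) + 4 * u / (1 + u\<^sup>2)\<^sup>2) has_real_derivative
           6 / ?q + (6 * ?q - 6 * u * (2 * u)) / ?q\<^sup>2 + (4 * ?q\<^sup>2 - 4 * u * (2 * ?q * (2 * u))) / ?q ^ 4) (at u)"
      by (rule derivative_eq_intros refl | simp)+ (simp add: divide_inverse power2_eq_square power4_eq_xxxx)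
    \<comment> \<open>Writing \<open>u\<^sup>2 = q - 1\<close> turns the claim into a rational
      identity in one variable.\<close>
    have "6 / q + (6 * q - 12 * (q - 1)) / q\<^sup>2 + (4 * q\<^sup>2 - 16 * (q - 1) * q) / q ^ 4 = 16 / q ^ 3"
      if "q \<noteq> 0" for q :: real
      using that by (simp add: field_simps power2_eq_square power3_eq_cube power4_eq_xxxx)
    from this[OF nz] show "6 / ?q + (6 * ?q - 6 * u * (2 * u)) / ?q\<^sup>2
        + (4 * ?q\<^sup>2 - 4 * u * (2 * ?q * (2 * u))) / ?q ^ 4 = 16 / ?q ^ 3"
      by (simp add: power2_eq_square mult_ac)
  qed
  \<comment> \<open>One order beyond the fourth, because \<open>zeros_bounded_Rolle\<close> also
    asks for a derivative of \<open>F'\<close>.\<close>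
  show "((\<lambda>u. 16 / (1 + u\<^sup>2) ^ 3) has_real_derivative (- 96 * u / (1 + u\<^sup>2) ^ 4)) (at u)"
    by (rule derivative_eq_intros refl | simp)+
       (use nz' in \<open>simp add: divide_simps power2_eq_square eval_nat_numeral\<close>)
qed

text \<open>The general bound would give five. Here the fourth derivative is a constant multiple of
  \<open>1 / (1 + u\<^sup>2) ^ 3\<close>, so it has no zeros or is identically zero, and four
  applications of Rolle give four.\<close>

lemma zeros_bounded_cubic_plus_cubic_arctan:
  assumes P: "degree P \<le> 3"
  shows "zeros_bounded {0<..} (\<lambda>u. poly P u + \<beta> * ((u + u ^ 3) * arctan u)) 4"
proof -
  let ?S = "{0::real<..}"
  have S: "is_interval ?S" "open ?S" by auto
  note D = cubic_arctan_derivatives[THEN DERIV_cmult[where c = \<beta>]]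
  have "degree ((pderiv ^^ 4) P) = degree P - 4" "(pderiv ^^ 4) P = pderiv ((pderiv ^^ 3) P)"
    by (simp_all add: degree_pderiv eval_nat_numeral)
  moreover have "degree ((pderiv ^^ 3) P) = degree P - 3"
    by (simp add: degree_pderiv eval_nat_numeral)
  ultimately have P4: "pderiv (pderiv (pderiv (pderiv P))) = 0"
    using P by (simp add: pderiv_eq_0_iff eval_nat_numeral)
  have "zeros_bounded ?S (\<lambda>u. poly ([:1, 0, 1:] ^ 3) u * (\<beta> * (16 / (1 + u\<^sup>2) ^ 3))) 0"
  proof -
    have "poly ([:1, 0, 1:] ^ 3) u * (\<beta> * (16 / (1 + u\<^sup>2) ^ 3)) = 16 * \<beta>" for u :: real
    proof -
      have "poly ([:1, 0, 1:] ^ 3) u = (1 + u\<^sup>2) ^ 3" by (simp add: poly_power power2_eq_square)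
      then show ?thesis by simp
    qed
    then show ?thesis by (simp only: zeros_bounded_const)
  qed
  then have Z4: "zeros_bounded ?S (\<lambda>u. \<beta> * (16 / (1 + u\<^sup>2) ^ 3)) 0"
  proof (rule zeros_bounded_mult[rotated 2])
    show "poly ([:1, 0, 1:] ^ 3) u \<noteq> 0" for u :: real
    proof -
      have "poly ([:1, 0, 1:] ^ 3) u = (1 + u\<^sup>2) ^ 3" by (simp add: poly_power power2_eq_square)
      then show ?thesis by simp
    qed
  qed (rule diffble_upto_poly)
  note R = zeros_bounded_Rolle[OF S DERIV_add[OF poly_DERIV D(1)] DERIV_add[OF poly_DERIV D(2)]]
    zeros_bounded_Rolle[OF S DERIV_add[OF poly_DERIV D(2)] DERIV_add[OF poly_DERIV D(3)]]
    zeros_bounded_Rolle[OF S DERIV_add[OF poly_DERIV D(3)] DERIV_add[OF poly_DERIV D(4)]]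
    zeros_bounded_Rolle[OF S DERIV_add[OF poly_DERIV D(4)] DERIV_add[OF poly_DERIV D(5)]]
  have "zeros_bounded ?S (\<lambda>u. poly P u + \<beta> * ((u + u ^ 3) * arctan u)) (Suc (Suc (Suc (Suc 0))))"
    by (intro R) (simp only: P4 poly_0 add_0 Z4)
  then show ?thesis by (simp add: eval_nat_numeral)
qed

lemma zeros_bounded_melnikov_1: "zeros_bounded {0<..} (melnikov 1 a b) 4"
proof -
  obtain P Q where P: "degree P \<le> 2 * 1 + 1" and Q: "degree Q \<le> (1 - 1) div 2"
    and M: "\<And>h. h > 0 \<Longrightarrow> melnikov 1 a b h = uh h * poly P (uh h) + h * poly Q h * arctan (uh h)"
    using melnikov_form_melnikov[of 1 a b] unfolding melnikov_form_def by blast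
  obtain \<beta> where "Q = [:\<beta>:]" using Q degree_eq_zeroE by (metis diff_self_eq_0 div_0 le_zero_eq)
  then show ?thesis using P zeros_bounded_cubic_plus_cubic_arctan[of P \<beta>]
    by (intro zeros_bounded_melnikov_form[OF M]) (simp_all add: algebra_simps)
qed

section \<open>From bounds on zeros to \<open>Hn\<close>\<close>

lemma vanishes_upto_zero_mult:
  assumes "diffble_upto k F x" "enat k \<le> zero_mult F x"
  shows "vanishes_upto k F x"
proof (rule vanishes_uptoI_higher_deriv[OF assms(1)])
  fix i assume "i < k"
  show "(deriv ^^ i) F x = 0"
  proof (rule ccontr)
    assume nz: "(deriv ^^ i) F x \<noteq> 0"
    then have "zero_mult F x = enat (LEAST k. (deriv ^^ k) F x \<noteq> 0)" unfolding zero_mult_def by auto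
    then have "k \<le> (LEAST k. (deriv ^^ k) F x \<noteq> 0)" using assms(2) by simp
    also have "\<dots> \<le> i" using nz by (rule Least_le)
    finally show False using \<open>i < k\<close> by simp
  qed
qed

lemma zero_mult_ge_1: "F x = 0 \<Longrightarrow> 1 \<le> zero_mult F x"
proof -
  assume "F x = 0"
  have "(LEAST k. (deriv ^^ k) F x \<noteq> 0) \<noteq> 0" if "(deriv ^^ k) F x \<noteq> 0" for k
    using LeastI[of "\<lambda>k. (deriv ^^ k) F x \<noteq> 0" k] that \<open>F x = 0\<close> by (metis funpow_0)
  then show ?thesis unfolding zero_mult_def by (auto simp: one_enat_def Suc_le_eq)
qed

text \<open>The same bound is used three times with different weights: to show that the zeros are
  finitely many, that each multiplicity is finite, and that the total is at most
  \<open>K\<close>.\<close>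

lemma nzeros_pos_le:
  assumes smooth: "\<And>k x. x > 0 \<Longrightarrow> diffble_upto k F x"
    and Z: "zeros_bounded {0<..} F K" and nz: "z > 0" "F z \<noteq> 0"
  shows "nzeros_pos F \<le> enat K"
proof -
  define X where "X = {x. 0 < x \<and> F x = 0}"
  have bound: "sum m Y \<le> K" if "finite Y" "Y \<subseteq> X" "\<And>x. x \<in> Y \<Longrightarrow> enat (m x) \<le> zero_mult F x" for Y m
  proof (rule zeros_boundedD[OF Z _ nz(2) that(1)])
    show "vanishes_upto (m x) F x" if "x \<in> Y" for x
      using that \<open>Y \<subseteq> X\<close> \<open>\<And>x. x \<in> Y \<Longrightarrow> enat (m x) \<le> zero_mult F x\<close>
      by (intro vanishes_upto_zero_mult smooth) (auto simp: X_def)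
  qed (use nz that in \<open>auto simp: X_def\<close>)
  have fin: "finite X"
  proof (rule ccontr)
    assume "infinite X"
    then obtain Y where Y: "Y \<subseteq> X" "finite Y" "card Y = Suc K" using infinite_arbitrarily_large by blast
    \<comment> \<open>Weight 1 at \<open>K + 1\<close> distinct zeros contradicts the bound.\<close>
    have "sum (\<lambda>_. 1) Y \<le> K"
      using Y zero_mult_ge_1[unfolded one_enat_def] by (intro bound) (auto simp: X_def)
    then show False using Y by simp
  qed
  have finm: "zero_mult F x \<noteq> \<infinity>" if "x \<in> X" for x
  proof
    assume "zero_mult F x = \<infinity>"
    \<comment> \<open>An infinite multiplicity permits the weight \<open>K + 1\<close> at a single
      point.\<close>
    then have "sum (\<lambda>_. Suc K) {x} \<le> K" using that by (intro bound) auto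
    then show False by simp
  qed
  have "nzeros_pos F = (\<Sum>x\<in>X. zero_mult F x)" using fin unfolding nzeros_pos_def X_def by simp
  also have "\<dots> = (\<Sum>x\<in>X. enat (the_enat (zero_mult F x)))"
    using finm by (intro sum.cong refl) (metis not_infinity_eq the_enat.simps)
  also have "\<dots> = enat (\<Sum>x\<in>X. the_enat (zero_mult F x))"
    using fin by (induction X rule: finite_induct) (auto simp: zero_enat_def)
  also have "\<dots> \<le> enat K"
  proof -
    have "enat (the_enat (zero_mult F x)) = zero_mult F x" if "x \<in> X" for x
      using finm[OF that] by (metis not_infinity_eq the_enat.simps)
    then show ?thesis using fin by (auto intro!: bound)
  qed
  finally show ?thesis .
qed

lemma nzeros_pos_ge_card:
  assumes "\<And>x. x \<in> Y \<Longrightarrow> 0 < x \<and> F x = 0"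
  shows "enat (card Y) \<le> nzeros_pos F"
proof (cases "finite {x. 0 < x \<and> F x = 0}")
  case True
  let ?X = "{x. 0 < x \<and> F x = 0}"
  have "enat (card Y) \<le> enat (card ?X)" using assms True by (auto intro!: card_mono)
  also have "\<dots> = (\<Sum>x\<in>?X. 1)" by (simp add: of_nat_eq_enat)
  also have "\<dots> \<le> (\<Sum>x\<in>?X. zero_mult F x)" using zero_mult_ge_1 by (intro sum_mono) auto
  finally show ?thesis using True by (simp add: nzeros_pos_def)
qed (simp add: nzeros_pos_def)

lemma Hn_le:
  assumes "\<And>a b. zeros_bounded {0<..} (melnikov n a b) K"
  shows "Hn n \<le> enat K"
  unfolding Hn_def
proof (rule Sup_least)
  fix N assume "N \<in> {nzeros_pos (melnikov n a b) | a b. \<exists>h>0. melnikov n a b h \<noteq> 0}"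
  then obtain a b h where N: "N = nzeros_pos (melnikov n a b)" "h > 0" "melnikov n a b h \<noteq> 0" by blast
  show "N \<le> enat K" unfolding N(1)
    by (rule nzeros_pos_le[OF _ assms N(2,3)]) (rule melnikov_form_diffble_upto[OF melnikov_form_melnikov])
qed

section \<open>Four zeros are attained for \<open>n = 1\<close>\<close>

lemma arc_int_zero: "arc_int (poly2 n (\<lambda>i j. 0)) (poly2 n (\<lambda>i j. 0)) h s t = 0"
  by (simp add: arc_int_def poly2_def)

lemma arc_int_affine:
  assumes "h > 0" "s \<le> t"
    and "\<And>x y. f x y = c + d * x" "\<And>x y. g x y = c' + d' * y"
  shows "arc_int f g h s t =
    (\<lambda>t. c' * (sqrt h * sin t) + c * (- (sqrt h * cos t)) + d' * h * (t / 2 + sin t * cos t / 2)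
        + d * h * (t / 2 - sin t * cos t / 2)) t -
    (\<lambda>t. c' * (sqrt h * sin t) + c * (- (sqrt h * cos t)) + d' * h * (t / 2 + sin t * cos t / 2)
        + d * h * (t / 2 - sin t * cos t / 2)) s"
  unfolding arc_int_def
proof (rule integral_eq_antiderivative[OF assms(2)])
  fix t
  have D: "((\<lambda>t. c' * (sqrt h * sin t) + c * (- (sqrt h * cos t)) + d' * h * (t / 2 + sin t * cos t / 2)
        + d * h * (t / 2 - sin t * cos t / 2)) has_real_derivative
      c' * (sqrt h * cos t) + c * (sqrt h * sin t) + d' * h * (1 / 2 + (cos t * cos t - sin t * sin t) / 2)
      + d * h * (1 / 2 - (cos t * cos t - sin t * sin t) / 2)) (at t)"
    by (rule derivative_eq_intros refl | simp)+ (simp add: field_simps)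
  have s2: "sin t * sin t = 1 - cos t * cos t"
    using sin_cos_squared_add[of t] by (simp add: power2_eq_square)
  have h: "sqrt h * sqrt h = h" using assms(1) by simp
  have 1: "1 / 2 + (cos t * cos t - sin t * sin t) / 2 = cos t * cos t"
    and 2: "1 / 2 - (cos t * cos t - sin t * sin t) / 2 = sin t * sin t"
    unfolding s2 by (simp_all add: field_simps)
  have "c' * (sqrt h * cos t) + c * (sqrt h * sin t) + d' * h * (1 / 2 + (cos t * cos t - sin t * sin t) / 2)
      + d * h * (1 / 2 - (cos t * cos t - sin t * sin t) / 2) =
      c' * (sqrt h * cos t) + c * (sqrt h * sin t) + d' * (sqrt h * sqrt h) * (cos t * cos t)
      + d * (sqrt h * sqrt h) * (sin t * sin t)"
    unfolding 1 2 h ..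
  also have "\<dots> = g (sqrt h * sin t) (sqrt h * cos t) * (sqrt h * cos t)
                 - f (sqrt h * sin t) (sqrt h * cos t) * (- (sqrt h * sin t))"
    unfolding assms(3,4) by (simp add: algebra_simps del: real_sqrt_mult_self)
  finally show "((\<lambda>t. c' * (sqrt h * sin t) + c * (- (sqrt h * cos t)) + d' * h * (t / 2 + sin t * cos t / 2)
        + d * h * (t / 2 - sin t * cos t / 2)) has_real_derivative
      g (sqrt h * sin t) (sqrt h * cos t) * (sqrt h * cos t)
                 - f (sqrt h * sin t) (sqrt h * cos t) * (- (sqrt h * sin t))) (at t)"
    using D by (simp only:)
qed

lemma
  assumes "h > 0"
  shows sqrt_sin_thA: "sqrt h * sin (thA h) = uh h"
    and sqrt_cos_thA: "sqrt h * cos (thA h) = (uh h)\<^sup>2"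
    and sin_cos_thA: "h * (sin (thA h) * cos (thA h)) = uh h ^ 3"
proof -
  show r: "sqrt h * sin (thA h) = uh h" "sqrt h * cos (thA h) = (uh h)\<^sup>2"
    using sqrt_sin_arctan_uh[OF assms] sqrt_cos_arctan_uh[OF assms]
    by (simp_all add: thA_eq[OF assms] sin_diff cos_diff)
  have "h * (sin (thA h) * cos (thA h)) = (sqrt h * sin (thA h)) * (sqrt h * cos (thA h))"
    using assms by (metis mult.assoc mult.left_commute real_sqrt_mult_self abs_of_pos)
  then show "h * (sin (thA h) * cos (thA h)) = uh h ^ 3"
    unfolding r by (simp add: power2_eq_square power3_eq_cube)
qed

text \<open>The limits \<open>thA h\<close> and \<open>pi - thA h\<close> have equal sines and
  opposite cosines, and half the angle swept is \<open>arctan (uh h)\<close>.\<close>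

lemma arc_int_affine_right:
  assumes h: "h > 0" and f: "\<And>x y. f x y = c + d * x" and g: "\<And>x y. g x y = d' * y"
  shows "arc_int f g h (thA h) (pi - thA h) =
    2 * c * (uh h)\<^sup>2 + d' * (h * arctan (uh h) - uh h ^ 3) + d * (h * arctan (uh h) + uh h ^ 3)"
proof -
  have at: "arctan (uh h) = pi / 2 - thA h" using thA_eq[OF h] by simp
  have g': "g x y = 0 + d' * y" for x y by (simp add: g)
  have "arc_int f g h (thA h) (pi - thA h) =
      2 * c * (sqrt h * cos (thA h)) + d' * (h * (pi / 2 - thA h) - h * (sin (thA h) * cos (thA h)))
      + d * (h * (pi / 2 - thA h) + h * (sin (thA h) * cos (thA h)))"
    using thA_bounds[OF h] by (subst arc_int_affine[OF h _ f g']) (simp_all add: algebra_simps diff_divide_distrib)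
  then show ?thesis unfolding sin_cos_thA[OF h] sqrt_cos_thA[OF h] at .
qed

lemma arc_int_affine_top:
  assumes h: "h > 0" and f: "\<And>x y. f x y = 0" and g: "\<And>x y. g x y = c + d * y"
  shows "arc_int f g h (2 * pi - thA h) (2 * pi + thA h) =
    2 * c * uh h + d * (h * thA h + uh h ^ 3)"
proof -
  have f': "f x y = 0 + 0 * x" for x y by (simp add: f)
  have "arc_int f g h (2 * pi - thA h) (2 * pi + thA h) =
      2 * c * (sqrt h * sin (thA h)) + d * (h * thA h + h * (sin (thA h) * cos (thA h)))"
    using thA_bounds[OF h] by (subst arc_int_affine[OF h _ f' g])
      (simp_all add: sin_diff cos_diff sin_add cos_add algebra_simps diff_divide_distrib add_divide_distrib)
  then show ?thesis unfolding sin_cos_thA[OF h] sqrt_sin_thA[OF h] .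
qed

lemma melnikov_1_realizes:
  "\<exists>a b. \<forall>h>0. melnikov 1 a b h = uh h * (poly [:c0, c1, c2, c3:] (uh h)
     + (uh h + uh h ^ 3) * arctan (uh h))"
proof -
  \<comment> \<open>The arcs used are the right and top ones. The constants of \<open>g_4\<close>
    and \<open>f_1\<close> produce \<open>u\<close> and \<open>u\<^sup>2\<close>. The linear term of
    \<open>g_4\<close> gives \<open>c3 * h\<close>, hence \<open>c3\<close> at both
    \<open>u\<^sup>2\<close> and \<open>u ^ 4\<close>, which explains \<open>c1 - c3\<close>; its
    by-product \<open>- 2 * c3 / pi * h * arctan u\<close> is offset by the term
    \<open>4 * c3 / pi\<close> in \<open>g_1\<close>. The linear terms of \<open>f_1\<close> and
    \<open>g_1\<close> are then balanced to give \<open>c2 * u ^ 3\<close> and \<open>arctan\<close>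
    coefficient \<open>h\<close>.\<close>
  define a :: "nat \<Rightarrow> nat \<Rightarrow> nat \<Rightarrow> real" where "a k i j = (if k = 1 then
     (if i = 0 \<and> j = 0 then (c1 - c3) / 2 else if i = 1 \<and> j = 0 then (1 + c2) / 2 else 0) else 0)" for k i j
  define b :: "nat \<Rightarrow> nat \<Rightarrow> nat \<Rightarrow> real" where "b k i j =
     (if k = 1 \<and> i = 0 \<and> j = 1 then (1 + 4 * c3 / pi - c2) / 2
      else if k = 4 \<and> i = 0 \<and> j = 0 then c0 / 2
      else if k = 4 \<and> i = 0 \<and> j = 1 then 2 * c3 / pi else 0)" for k i j
  show ?thesis
  proof (intro exI allI impI)
    fix h :: real assume h: "h > 0"
    let ?u = "uh h" let ?\<theta> = "thA h"
    show "melnikov 1 a b h = ?u * (poly [:c0, c1, c2, c3:] ?u + (?u + ?u ^ 3) * arctan ?u)"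
    proof -
      have at: "arctan ?u = pi / 2 - ?\<theta>" using thA_eq[OF h] by simp
      have arc1: "arc_int (poly2 1 (a 1)) (poly2 1 (b 1)) h ?\<theta> (pi - ?\<theta>) =
          2 * ((c1 - c3) / 2) * ?u\<^sup>2 + (1 + 4 * c3 / pi - c2) / 2 * (h * arctan ?u - ?u ^ 3)
          + (1 + c2) / 2 * (h * arctan ?u + ?u ^ 3)"
        by (rule arc_int_affine_right[OF h]) (simp_all add: poly2_def a_def b_def)
      have zero: "poly2 1 (a k) = poly2 1 (\<lambda>i j. 0)" "poly2 1 (b k) = poly2 1 (\<lambda>i j. 0)" if "k \<in> {2, 3}" for k
        using that by (auto simp: fun_eq_iff poly2_def a_def b_def)
      have arc4: "arc_int (poly2 1 (a 4)) (poly2 1 (b 4)) h (2 * pi - ?\<theta>) (2 * pi + ?\<theta>) =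
          2 * (c0 / 2) * ?u + 2 * c3 / pi * (h * ?\<theta> + ?u ^ 3)"
        by (rule arc_int_affine_top[OF h]) (simp_all add: poly2_def a_def b_def)
      have "c3 * (?u ^ 4 + ?u\<^sup>2) = c3 * h" using uh_quartic[OF h] by simp
      then have u4: "c3 * (?u * (?u * (?u * ?u))) = c3 * h - c3 * (?u * ?u)"
        by (simp add: power2_eq_square power4_eq_xxxx algebra_simps)
      have hu: "?u * ((?u + ?u ^ 3) * y) = h * y" for y
      proof -
        have "?u * (?u + ?u ^ 3) = h"
          using uh_quartic[OF h] by (simp add: power2_eq_square power3_eq_cube power4_eq_xxxx algebra_simps)
        then show ?thesis by (simp only: mult.assoc[symmetric])
      qed
      have "melnikov 1 a b h = (c1 - c3) * ?u\<^sup>2 + (1 + 4 * c3 / pi - c2) / 2 * (h * arctan ?u - ?u ^ 3)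
          + (1 + c2) / 2 * (h * arctan ?u + ?u ^ 3) + (c0 * ?u + 2 * c3 / pi * (h * ?\<theta> + ?u ^ 3))"
        unfolding melnikov_def Let_def by (simp add: arc1 arc4 zero arc_int_zero del: One_nat_def)
      also have "h * ?\<theta> = h * pi / 2 - h * arctan ?u" unfolding at by (simp add: field_simps)
      also have "(c1 - c3) * ?u\<^sup>2 + (1 + 4 * c3 / pi - c2) / 2 * (h * arctan ?u - ?u ^ 3)
          + (1 + c2) / 2 * (h * arctan ?u + ?u ^ 3) + (c0 * ?u + 2 * c3 / pi * (h * pi / 2 - h * arctan ?u + ?u ^ 3))
          = c0 * ?u + (c1 - c3) * ?u\<^sup>2 + c2 * ?u ^ 3 + c3 * h + h * arctan ?u"
        by (simp add: field_simps)
      also have "\<dots> = ?u * (poly [:c0, c1, c2, c3:] ?u + (?u + ?u ^ 3) * arctan ?u)"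
        unfolding distrib_left[of ?u] hu using u4
        by (simp add: power2_eq_square power3_eq_cube algebra_simps)
      finally show ?thesis .
    qed
  qed
qed

lemma DERIV_eq_0_on_open:
  assumes "open S" "\<And>x. x \<in> S \<Longrightarrow> F x = 0" "\<And>x. x \<in> S \<Longrightarrow> (F has_real_derivative F' x) (at x)" "x \<in> S"
  shows "F' x = 0"
proof -
  have "((\<lambda>_. 0) has_real_derivative F' x) (at x)"
    using has_field_derivative_transform_within_open[OF assms(3)[OF assms(4)] assms(1,4) assms(2)] .
  then show ?thesis using DERIV_unique DERIV_const by blast
qed

text \<open>Otherwise the fourth derivative \<open>16 / (1 + u\<^sup>2) ^ 3\<close> would vanish.
  This guarantees that the interpolated Melnikov function is not identically zero.\<close>

lemma cubic_arctan_not_cubic: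
  assumes "degree P \<le> 3"
  shows "\<exists>u>0. poly P u + (u + u ^ 3) * arctan u \<noteq> 0"
proof (rule ccontr)
  assume "\<not> ?thesis"
  then have 0: "poly P u + (u + u ^ 3) * arctan u = 0" if "u \<in> {0<..}" for u using that by auto
  have P4: "pderiv (pderiv (pderiv (pderiv P))) = 0"
    using assms by (simp add: pderiv_eq_0_iff degree_pderiv)
  note S = open_greaterThan[of "0::real"]
  note 1 = DERIV_eq_0_on_open[OF S 0 DERIV_add[OF poly_DERIV cubic_arctan_derivatives(1)]]
  note 2 = DERIV_eq_0_on_open[OF S 1 DERIV_add[OF poly_DERIV cubic_arctan_derivatives(2)]]
  note 3 = DERIV_eq_0_on_open[OF S 2 DERIV_add[OF poly_DERIV cubic_arctan_derivatives(3)]]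
  note 4 = DERIV_eq_0_on_open[OF S 3 DERIV_add[OF poly_DERIV cubic_arctan_derivatives(4)]]
  show False using 4[of 1] by (simp add: P4)
qed

lemma cubic_interpolation:
  fixes y0 y1 y2 y3 :: real
  shows "\<exists>c0 c1 c2 c3. poly [:c0, c1, c2, c3:] 1 = y0 \<and> poly [:c0, c1, c2, c3:] 2 = y1 \<and>
    poly [:c0, c1, c2, c3:] 3 = y2 \<and> poly [:c0, c1, c2, c3:] 4 = y3"
proof -
  \<comment> \<open>The divided differences at the nodes 1, 2, 3, 4; the witnesses are the
    coefficients of Newton's form \<open>y0 + d1 (x - 1) + d2 (x - 1) (x - 2) + d3 (x - 1) (x - 2)
    (x - 3)\<close>, expanded.\<close>
  define d1 d2 d3 where "d1 = y1 - y0" and "d2 = (y2 - 2 * y1 + y0) / 2"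
    and "d3 = (y3 - 3 * y2 + 3 * y1 - y0) / 6"
  show ?thesis
    by (rule exI[of _ "y0 - d1 + 2 * d2 - 6 * d3"], rule exI[of _ "d1 - 3 * d2 + 11 * d3"],
        rule exI[of _ "d2 - 6 * d3"], rule exI[of _ d3])
       (simp add: d1_def d2_def d3_def field_simps)
qed

lemma Hn_1_ge: "4 \<le> Hn 1"
proof -
  \<comment> \<open>The prescribed values are \<open>- (u + u ^ 3) * arctan u\<close> at
    \<open>u = 1, 2, 3, 4\<close>, which makes \<open>?G\<close> vanish at these points.\<close>
  obtain c0 c1 c2 c3 where c: "poly [:c0, c1, c2, c3:] 1 = - (2 * arctan 1)"
    "poly [:c0, c1, c2, c3:] 2 = - (10 * arctan 2)" "poly [:c0, c1, c2, c3:] 3 = - (30 * arctan 3)"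
    "poly [:c0, c1, c2, c3:] 4 = - (68 * arctan 4)"
    using cubic_interpolation by blast
  let ?G = "\<lambda>u. poly [:c0, c1, c2, c3:] u + (u + u ^ 3) * arctan u"
  obtain a b where M: "\<And>h. h > 0 \<Longrightarrow> melnikov 1 a b h = uh h * ?G (uh h)"
    using melnikov_1_realizes[of c0 c1 c2 c3] by blast
  have M_quartic: "melnikov 1 a b (u\<^sup>2 + u ^ 4) = u * ?G u" "u\<^sup>2 + u ^ 4 > 0" if "u > 0" for u
  proof -
    show pos: "u\<^sup>2 + u ^ 4 > 0" using that by (simp add: add_pos_pos)
    show "melnikov 1 a b (u\<^sup>2 + u ^ 4) = u * ?G u" unfolding M[OF pos] uh_of_quartic[OF that] ..
  qed
  have "degree [:c0, c1, c2, c3:] \<le> 3" by simp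
  then obtain u where u: "u > 0" "?G u \<noteq> 0" using cubic_arctan_not_cubic by blast
  then have "\<exists>h>0. melnikov 1 a b h \<noteq> 0"
    using M_quartic[OF u(1)] by (metis mult_eq_0_iff less_irrefl)
  then have "nzeros_pos (melnikov 1 a b) \<le> Hn 1"
    unfolding Hn_def by (intro Sup_upper) blast
  moreover have "enat (card ((\<lambda>u. u\<^sup>2 + u ^ 4) ` {1, 2, 3, 4::real})) \<le> nzeros_pos (melnikov 1 a b)"
  proof (rule nzeros_pos_ge_card)
    fix h assume "h \<in> (\<lambda>u. u\<^sup>2 + u ^ 4) ` {1, 2, 3, 4::real}"
    then obtain v where v: "v \<in> {1, 2, 3, 4::real}" "h = v\<^sup>2 + v ^ 4" by blast
    have "?G v = 0" using v(1) c by (elim insertE) (simp_all only: empty_iff, simp_all)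
    moreover have "v > 0" using v(1) by auto
    ultimately show "0 < h \<and> melnikov 1 a b h = 0" using M_quartic[of v] v(2) by simp
  qed
  moreover have "card ((\<lambda>u. u\<^sup>2 + u ^ 4) ` {1, 2, 3, 4::real}) = 4" by simp
  ultimately have "enat 4 \<le> Hn 1" by (simp only:)
  then show ?thesis by (simp only: numeral_eq_enat)
qed

theorem theorem1p1:
  shows "Hn 1 = 4 \<and> (\<forall>n\<ge>2. Hn n \<le> enat (2 * n + 5 * ((n - 1) div 2) + 4))"
proof (intro conjI allI impI)
  have "Hn 1 \<le> enat 4" by (rule Hn_le[OF zeros_bounded_melnikov_1])
  then show "Hn 1 = 4" using Hn_1_ge by (simp add: numeral_eq_enat)
next
  fix n :: nat assume n: "n \<ge> 2"
  have "Hn n \<le> enat (3 * n + 2)" using n by (intro Hn_le zeros_bounded_melnikov) simp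
  \<comment> \<open>This amounts to \<open>n - 2 \<le> 5 * ((n - 1) div 2)\<close>, an equality at
    \<open>n = 2\<close>.\<close>
  also have "\<dots> \<le> enat (2 * n + 5 * ((n - 1) div 2) + 4)" using n by simp
  finally show "Hn n \<le> enat (2 * n + 5 * ((n - 1) div 2) + 4)" .
qed

end
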